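(* Let $p$ be a prime and let $G$ be a finite $p$-group of nilpotency class $c\geq 1$. (i) If $p$ is odd, then $\exp(D(G))$ divides $\exp(G)^{n}$ and $\exp(\chi(G))$ divides $\exp(G)^{n+1}$, where $n=\lceil \log_{p-1}(c+1)\rceil$. (ii) If $p=2$, then $\exp(D(G))$ divides $2^{m}\cdot\exp(G)^{m+1}$ and $\exp(\chi(G))$ divides $2^{m}\cdot\exp(G)^{m+2}$, where $m=\lfloor \log_2(c)\rfloor$.
   Context: For a group $G$, let $G^{\varphi}$ be a copy of $G$, isomorphic to $G$ via $\varphi: G\to G^{\varphi}$, $g\mapsto g^{\varphi}$. The weak commutativity group of $G$ is $\chi(G)=\langle G\cup G^{\varphi}\mid [g,g^{\varphi}]=1 \text{ for all } g\in G\rangle$, i.e. the quotient of the free product $G * G^{\varphi}$ by the normal closure of all $[g,g^{\varphi}]$, $g\in G$; the groups $G$ and $G^{\varphi}$ are identified with their (isomorphic) images in $\chi(G)$. Commutators are $[x,y]=x^{-1}y^{-1}xy$. $D(G)=[G,G^{\varphi}]=\langle [g,h^{\varphi}]\mid g,h\in G\rangle\leq\chi(G)$. $\exp(X)$ denotes the exponent of a group $X$. *)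

theory Defs
  imports Complex_Main "HOL-Algebra.Generated_Groups" "HOL-Computational_Algebra.Primes"
begin

section \<open>Exponent, commutators, nilpotency class\<close>

text \<open>A group without finite exponent gets the value \<open>0\<close>, so that a divisibility
  \<open>group_exponent G dvd k\<close> with \<open>k > 0\<close> includes the claim that the exponent is finite.\<close>

definition group_exponent :: "('a, 'b) monoid_scheme \<Rightarrow> nat" where
  "group_exponent G =
     (if \<exists>n>0. \<forall>x\<in>carrier G. x [^]\<^bsub>G\<^esub> (n::nat) = \<one>\<^bsub>G\<^esub>
      then LEAST n::nat. n > 0 \<and> (\<forall>x\<in>carrier G. x [^]\<^bsub>G\<^esub> n = \<one>\<^bsub>G\<^esub>)
      else 0)"

definition commutator :: "('a, 'b) monoid_scheme \<Rightarrow> 'a \<Rightarrow> 'a \<Rightarrow> 'a" where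
  "commutator G x y = inv\<^bsub>G\<^esub> x \<otimes>\<^bsub>G\<^esub> inv\<^bsub>G\<^esub> y \<otimes>\<^bsub>G\<^esub> x \<otimes>\<^bsub>G\<^esub> y"

definition commutator_subgroup :: "('a, 'b) monoid_scheme \<Rightarrow> 'a set \<Rightarrow> 'a set \<Rightarrow> 'a set" where
  "commutator_subgroup G X Y = generate G {commutator G x y | x y. x \<in> X \<and> y \<in> Y}"

text \<open>Indexing is shifted by one: \<open>lower_central G k\<close> is \<open>\<gamma>\<^bsub>k+1\<^esub>(G)\<close>.\<close>

primrec lower_central :: "('a, 'b) monoid_scheme \<Rightarrow> nat \<Rightarrow> 'a set" where
  "lower_central G 0 = carrier G"
| "lower_central G (Suc k) = commutator_subgroup G (lower_central G k) (carrier G)"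

definition has_nilpotency_class :: "('a, 'b) monoid_scheme \<Rightarrow> nat \<Rightarrow> bool" where
  "has_nilpotency_class G c \<longleftrightarrow>
     lower_central G c = {\<one>\<^bsub>G\<^esub>} \<and> (\<forall>k<c. lower_central G k \<noteq> {\<one>\<^bsub>G\<^esub>})"


section \<open>Free products\<close>

text \<open>The free product of \<open>G\<close> and \<open>H\<close> consists of the words over the disjoint union of the two
  carriers, modulo the congruence generated by the multiplication tables of \<open>G\<close> and \<open>H\<close>.\<close>

definition fp_words :: "('a, 'c) monoid_scheme \<Rightarrow> ('b, 'd) monoid_scheme \<Rightarrow> ('a + 'b) list set" where
  "fp_words G H = lists (carrier G <+> carrier H)"

inductive_set fp_rel ::
    "('a, 'c) monoid_scheme \<Rightarrow> ('b, 'd) monoid_scheme \<Rightarrow> (('a + 'b) list \<times> ('a + 'b) list) set"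
  for G H where
    refl: "u \<in> fp_words G H \<Longrightarrow> (u, u) \<in> fp_rel G H"
  | sym: "(u, v) \<in> fp_rel G H \<Longrightarrow> (v, u) \<in> fp_rel G H"
  | trans: "(u, v) \<in> fp_rel G H \<Longrightarrow> (v, w) \<in> fp_rel G H \<Longrightarrow> (u, w) \<in> fp_rel G H"
  | append: "(u, u') \<in> fp_rel G H \<Longrightarrow> (v, v') \<in> fp_rel G H \<Longrightarrow> (u @ v, u' @ v') \<in> fp_rel G H"
  | one_left: "([Inl \<one>\<^bsub>G\<^esub>], []) \<in> fp_rel G H"
  | one_right: "([Inr \<one>\<^bsub>H\<^esub>], []) \<in> fp_rel G H"
  | mult_left: "x \<in> carrier G \<Longrightarrow> y \<in> carrier G \<Longrightarrow>
      ([Inl x, Inl y], [Inl (x \<otimes>\<^bsub>G\<^esub> y)]) \<in> fp_rel G H"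
  | mult_right: "x \<in> carrier H \<Longrightarrow> y \<in> carrier H \<Longrightarrow>
      ([Inr x, Inr y], [Inr (x \<otimes>\<^bsub>H\<^esub> y)]) \<in> fp_rel G H"

definition free_product ::
    "('a, 'c) monoid_scheme \<Rightarrow> ('b, 'd) monoid_scheme \<Rightarrow> ('a + 'b) list set monoid" where
  "free_product G H =
     \<lparr>carrier = fp_words G H // fp_rel G H,
      monoid.mult = (\<lambda>A B. \<Union>u\<in>A. \<Union>v\<in>B. fp_rel G H `` {u @ v}),
      one = fp_rel G H `` {[]}\<rparr>"

definition fp_inl ::
    "('a, 'c) monoid_scheme \<Rightarrow> ('b, 'd) monoid_scheme \<Rightarrow> 'a \<Rightarrow> ('a + 'b) list set" where
  "fp_inl G H x = fp_rel G H `` {[Inl x]}"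

definition fp_inr ::
    "('a, 'c) monoid_scheme \<Rightarrow> ('b, 'd) monoid_scheme \<Rightarrow> 'b \<Rightarrow> ('a + 'b) list set" where
  "fp_inr G H x = fp_rel G H `` {[Inr x]}"


section \<open>The weak commutativity group\<close>

definition normal_closure :: "('a, 'b) monoid_scheme \<Rightarrow> 'a set \<Rightarrow> 'a set" where
  "normal_closure G S =
     generate G {x \<otimes>\<^bsub>G\<^esub> s \<otimes>\<^bsub>G\<^esub> inv\<^bsub>G\<^esub> x | x s. x \<in> carrier G \<and> s \<in> S}"

text \<open>The copy \<open>G\<^sup>\<phi>\<close> is the second factor of the free product of \<open>G\<close> with itself;
  the tags \<open>Inl\<close> and \<open>Inr\<close> keep the two factors disjoint.\<close>

definition weak_comm_relators :: "('a, 'b) monoid_scheme \<Rightarrow> ('a + 'a) list set set" where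
  "weak_comm_relators G =
     {commutator (free_product G G) (fp_inl G G g) (fp_inr G G g) | g. g \<in> carrier G}"

definition weak_comm_kernel :: "('a, 'b) monoid_scheme \<Rightarrow> ('a + 'a) list set set" where
  "weak_comm_kernel G = normal_closure (free_product G G) (weak_comm_relators G)"

definition chi :: "('a, 'b) monoid_scheme \<Rightarrow> ('a + 'a) list set set monoid" where
  "chi G = free_product G G Mod weak_comm_kernel G"

definition chi_left :: "('a, 'b) monoid_scheme \<Rightarrow> 'a \<Rightarrow> ('a + 'a) list set set" where
  "chi_left G g = weak_comm_kernel G #>\<^bsub>free_product G G\<^esub> fp_inl G G g"

text \<open>\<open>chi_right G g\<close> is \<open>g\<^sup>\<phi>\<close>.\<close>

definition chi_right :: "('a, 'b) monoid_scheme \<Rightarrow> 'a \<Rightarrow> ('a + 'a) list set set" where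
  "chi_right G g = weak_comm_kernel G #>\<^bsub>free_product G G\<^esub> fp_inr G G g"

definition D_subgroup :: "('a, 'b) monoid_scheme \<Rightarrow> ('a + 'a) list set set set" where
  "D_subgroup G =
     commutator_subgroup (chi G) (chi_left G ` carrier G) (chi_right G ` carrier G)"


section \<open>Basic facts\<close>

lemma fp_rel_words:
  assumes "group G" "group H" "(u, v) \<in> fp_rel G H"
  shows "u \<in> fp_words G H \<and> v \<in> fp_words G H"
proof -
  interpret G: group G by fact
  interpret H: group H by fact
  show ?thesis
    using assms(3) by induction (simp_all add: fp_words_def Plus_def)
qed

lemma equiv_fp_rel:
  assumes "group G" "group H"
  shows "equiv (fp_words G H) (fp_rel G H)"
proof (rule equivI)
  show "fp_rel G H \<subseteq> fp_words G H \<times> fp_words G H"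
    using fp_rel_words[OF assms] by auto
  show "refl_on (fp_words G H) (fp_rel G H)"
    by (auto simp: refl_on_def intro: fp_rel.refl)
  show "Relation.sym (fp_rel G H)"
    by (rule symI) (rule fp_rel.sym)
  show "Relation.trans (fp_rel G H)"
    by (rule transI) (rule fp_rel.trans)
qed

lemma fp_mult_class:
  assumes "group G" "group H" "u \<in> fp_words G H" "v \<in> fp_words G H"
  shows "fp_rel G H `` {u} \<otimes>\<^bsub>free_product G H\<^esub> fp_rel G H `` {v} = fp_rel G H `` {u @ v}"
proof -
  have "fp_rel G H `` {u' @ v'} = fp_rel G H `` {u @ v}"
    if "u' \<in> fp_rel G H `` {u}" "v' \<in> fp_rel G H `` {v}" for u' v'
  proof (rule equiv_class_eq[OF equiv_fp_rel[OF assms(1,2)], symmetric])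
    show "(u @ v, u' @ v') \<in> fp_rel G H"
      using that by (intro fp_rel.append) simp_all
  qed
  moreover have "u \<in> fp_rel G H `` {u}" "v \<in> fp_rel G H `` {v}"
    using fp_rel.refl[OF assms(3)] fp_rel.refl[OF assms(4)] by simp_all
  ultimately have "(\<Union>u'\<in>fp_rel G H `` {u}. \<Union>v'\<in>fp_rel G H `` {v}. fp_rel G H `` {u' @ v'}) =
      fp_rel G H `` {u @ v}"
    by blast
  then show ?thesis
    by (simp add: free_product_def)
qed

lemma fp_carrier_cases:
  assumes "A \<in> carrier (free_product G H)"
  obtains u where "u \<in> fp_words G H" "A = fp_rel G H `` {u}"
  using assms unfolding free_product_def by (auto elim: quotientE)

lemma fp_class_in_carrier:
  "u \<in> fp_words G H \<Longrightarrow> fp_rel G H `` {u} \<in> carrier (free_product G H)"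
  unfolding free_product_def by (auto intro: quotientI)

lemma fp_words_simps [simp]:
  "[] \<in> fp_words G H"
  "u @ v \<in> fp_words G H \<longleftrightarrow> u \<in> fp_words G H \<and> v \<in> fp_words G H"
  "Inl x # u \<in> fp_words G H \<longleftrightarrow> x \<in> carrier G \<and> u \<in> fp_words G H"
  "Inr y # u \<in> fp_words G H \<longleftrightarrow> y \<in> carrier H \<and> u \<in> fp_words G H"
  by (auto simp: fp_words_def)

lemma fp_one: "\<one>\<^bsub>free_product G H\<^esub> = fp_rel G H `` {[]}"
  by (simp add: free_product_def)

lemma fp_left_inverse:
  assumes "group G" "group H" "u \<in> fp_words G H"
  shows "\<exists>v\<in>fp_words G H. (v @ u, []) \<in> fp_rel G H"
  using assms(3)
proof (induction u)
  case Nil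
  then show ?case by (auto intro!: bexI[of _ "[]"] fp_rel.refl)
next
  case (Cons a u)
  interpret G: group G by fact
  interpret H: group H by fact
  from Cons obtain v where v: "v \<in> fp_words G H" "(v @ u, []) \<in> fp_rel G H"
    by (cases a) auto
  have "\<exists>b. [b] \<in> fp_words G H \<and> ([b, a], []) \<in> fp_rel G H"
  proof (cases a)
    case (Inl x)
    with Cons.prems have x: "x \<in> carrier G" by simp
    have "([Inl (inv\<^bsub>G\<^esub> x), Inl x], []) \<in> fp_rel G H"
      using fp_rel.trans[OF fp_rel.mult_left[OF G.inv_closed[OF x] x]] fp_rel.one_left
      unfolding G.l_inv[OF x] by blast
    with x Inl show ?thesis by (intro exI[of _ "Inl (inv\<^bsub>G\<^esub> x)"]) simp
  next
    case (Inr x)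
    with Cons.prems have x: "x \<in> carrier H" by simp
    have "([Inr (inv\<^bsub>H\<^esub> x), Inr x], []) \<in> fp_rel G H"
      using fp_rel.trans[OF fp_rel.mult_right[OF H.inv_closed[OF x] x]] fp_rel.one_right
      unfolding H.l_inv[OF x] by blast
    with x Inr show ?thesis by (intro exI[of _ "Inr (inv\<^bsub>H\<^esub> x)"]) simp
  qed
  then obtain b where b: "[b] \<in> fp_words G H" "([b, a], []) \<in> fp_rel G H" by blast
  have u: "u \<in> fp_words G H" using Cons.prems by (cases a) auto
  have "(v @ ([b, a] @ u), v @ ([] @ u)) \<in> fp_rel G H"
    by (intro fp_rel.append fp_rel.refl b v u)
  then have "((v @ [b]) @ a # u, []) \<in> fp_rel G H"
    using fp_rel.trans[OF _ v(2)] by simp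
  with v b show ?case by (intro bexI[of _ "v @ [b]"]) simp_all
qed

lemma group_free_product:
  assumes "group G" "group H"
  shows "group (free_product G H)"
proof (rule groupI)
  note mult = fp_mult_class[OF assms]
  show "\<one>\<^bsub>free_product G H\<^esub> \<in> carrier (free_product G H)"
    by (simp add: fp_one fp_class_in_carrier)
  fix A assume A: "A \<in> carrier (free_product G H)"
  then obtain u where u: "u \<in> fp_words G H" "A = fp_rel G H `` {u}"
    by (rule fp_carrier_cases)
  show "\<one>\<^bsub>free_product G H\<^esub> \<otimes>\<^bsub>free_product G H\<^esub> A = A"
    using u by (simp add: fp_one mult)
  obtain v where v: "v \<in> fp_words G H" "(v @ u, []) \<in> fp_rel G H"
    using fp_left_inverse[OF assms u(1)] by blast
  show "\<exists>B\<in>carrier (free_product G H). B \<otimes>\<^bsub>free_product G H\<^esub> A = \<one>\<^bsub>free_product G H\<^esub>"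
    using u v equiv_class_eq[OF equiv_fp_rel[OF assms] v(2)]
    by (intro bexI[of _ "fp_rel G H `` {v}"]) (simp_all add: fp_one mult fp_class_in_carrier)
  fix B assume "B \<in> carrier (free_product G H)"
  then obtain v where v: "v \<in> fp_words G H" "B = fp_rel G H `` {v}"
    by (rule fp_carrier_cases)
  show "A \<otimes>\<^bsub>free_product G H\<^esub> B \<in> carrier (free_product G H)"
    using u v by (simp add: mult fp_class_in_carrier)
  fix C assume "C \<in> carrier (free_product G H)"
  then obtain w where w: "w \<in> fp_words G H" "C = fp_rel G H `` {w}"
    by (rule fp_carrier_cases)
  show "A \<otimes>\<^bsub>free_product G H\<^esub> B \<otimes>\<^bsub>free_product G H\<^esub> C =
        A \<otimes>\<^bsub>free_product G H\<^esub> (B \<otimes>\<^bsub>free_product G H\<^esub> C)"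
    using u v w by (simp add: mult)
qed

lemma fp_inl_hom:
  assumes "group G" "group H"
  shows "fp_inl G H \<in> hom G (free_product G H)"
proof (rule homI)
  fix x assume "x \<in> carrier G"
  then show "fp_inl G H x \<in> carrier (free_product G H)"
    by (simp add: fp_inl_def fp_class_in_carrier)
next
  fix x y assume xy: "x \<in> carrier G" "y \<in> carrier G"
  have "fp_rel G H `` {[Inl x, Inl y]} = fp_rel G H `` {[Inl (x \<otimes>\<^bsub>G\<^esub> y)]}"
    by (rule equiv_class_eq[OF equiv_fp_rel[OF assms]]) (rule fp_rel.mult_left[OF xy])
  with xy show "fp_inl G H (x \<otimes>\<^bsub>G\<^esub> y) =
      fp_inl G H x \<otimes>\<^bsub>free_product G H\<^esub> fp_inl G H y"
    by (simp add: fp_inl_def fp_mult_class[OF assms])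
qed

lemma fp_inr_hom:
  assumes "group G" "group H"
  shows "fp_inr G H \<in> hom H (free_product G H)"
proof (rule homI)
  fix x assume "x \<in> carrier H"
  then show "fp_inr G H x \<in> carrier (free_product G H)"
    by (simp add: fp_inr_def fp_class_in_carrier)
next
  fix x y assume xy: "x \<in> carrier H" "y \<in> carrier H"
  have "fp_rel G H `` {[Inr x, Inr y]} = fp_rel G H `` {[Inr (x \<otimes>\<^bsub>H\<^esub> y)]}"
    by (rule equiv_class_eq[OF equiv_fp_rel[OF assms]]) (rule fp_rel.mult_right[OF xy])
  with xy show "fp_inr G H (x \<otimes>\<^bsub>H\<^esub> y) =
      fp_inr G H x \<otimes>\<^bsub>free_product G H\<^esub> fp_inr G H y"
    by (simp add: fp_inr_def fp_mult_class[OF assms])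
qed

lemma (in group) normal_closure_normal:
  assumes "S \<subseteq> carrier G"
  shows "normal_closure G S \<lhd> G"
  unfolding normal_closure_def
proof (rule normal_generateI)
  show "{x \<otimes> s \<otimes> inv x |x s. x \<in> carrier G \<and> s \<in> S} \<subseteq> carrier G"
    using assms by (blast intro: m_closed inv_closed)
next
  fix h g assume "h \<in> {x \<otimes> s \<otimes> inv x |x s. x \<in> carrier G \<and> s \<in> S}" and g: "g \<in> carrier G"
  then obtain x s where xs: "x \<in> carrier G" "s \<in> S" "h = x \<otimes> s \<otimes> inv x" by blast
  have s: "s \<in> carrier G" using assms xs by blast
  have "g \<otimes> h \<otimes> inv g = (g \<otimes> x) \<otimes> s \<otimes> inv (g \<otimes> x)"
    using g s xs by (simp add: m_assoc inv_mult_group)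
  then show "g \<otimes> h \<otimes> inv g \<in> {x \<otimes> s \<otimes> inv x |x s. x \<in> carrier G \<and> s \<in> S}"
    using g xs by blast
qed

lemma weak_comm_relators_carrier:
  assumes "group G"
  shows "weak_comm_relators G \<subseteq> carrier (free_product G G)"
proof -
  interpret F: group "free_product G G" by (rule group_free_product[OF assms assms])
  have "commutator (free_product G G) (fp_inl G G g) (fp_inr G G g) \<in> carrier (free_product G G)"
    if "g \<in> carrier G" for g
    unfolding commutator_def
    by (intro F.m_closed F.inv_closed hom_in_carrier[OF fp_inl_hom[OF assms assms] that]
        hom_in_carrier[OF fp_inr_hom[OF assms assms] that])
  then show ?thesis
    unfolding weak_comm_relators_def by blast
qed

lemma weak_comm_kernel_normal:
  assumes "group G"
  shows "weak_comm_kernel G \<lhd> free_product G G"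
  unfolding weak_comm_kernel_def
  by (intro group.normal_closure_normal group_free_product weak_comm_relators_carrier assms)

lemma group_chi: "group G \<Longrightarrow> group (chi G)"
  unfolding chi_def by (rule normal.factorgroup_is_group[OF weak_comm_kernel_normal])

end

theory Submission
  imports Defs "HOL-Library.Function_Algebras" "HOL-Library.Function_Division"
    "HOL-Algebra.Multiplicative_Group"
begin

text \<open>
  Write \<open>{g, h} = [g, h\<^sup>\<phi>]\<close> and \<open>\<gamma>\<^sub>k = \<gamma>\<^sub>k(G)\<close>. The relations give \<open>{g, h} = [g\<^sup>\<phi>, h]\<close>; expanding
  \<open>{gk, h}\<close> in both ways shows that \<open>k\<close> and \<open>k\<^sup>\<phi>\<close> induce the same automorphism of \<open>D\<close>, and
  \<open>\<chi>(G)/D\<close> is a quotient of \<open>G \<times> G\<close>. So it suffices to bound \<open>exp D\<close>, and this is done along the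
  chain \<open>M\<^sub>k = [\<gamma>\<^bsub>(p-1)^k\<^esub>, G\<^sup>\<phi>]\<close> of normal subgroups (\<open>\<gamma>\<^bsub>2^k\<^esub>\<close> if \<open>p = 2\<close>), showing \<open>y\<^sup>e \<in> M\<^bsub>k+1\<^esub>\<close> for
  \<open>y \<in> M\<^sub>k\<close>, \<open>e = exp G\<close> (\<open>y\<^bsup>2e\<^esup>\<close> if \<open>p = 2\<close> and \<open>k > 0\<close>).

  For one step, work modulo \<open>M\<^bsub>k+1\<^esub>\<close>, put \<open>m = (p-1)^k\<close> and let \<open>x \<in> \<gamma>\<^sub>m\<close>. Then \<open>\<gamma>\<^bsub>(p-1)m\<^esub>\<close> centralises
  \<open>D\<close>, which forces \<open>\<gamma>\<^sub>p\<langle>x, {x, h}\<rangle> = 1\<close>: for \<open>m \<ge> 2\<close> because \<open>\<gamma>\<^sub>2\<close> centralises \<open>Z(D)\<close>, and for \<open>m = 1\<close>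
  because \<open>[{s, x}, x] = {[s, x], x}\<close> and because commutators of elements of \<open>D\<close> of large total
  weight are central. As \<open>x\<close> and \<open>x\<^bsup>h\<^sup>\<phi>\<^esup> = x{x, h}\<close> have order dividing \<open>e\<close> and groups of
  class less than \<open>p\<close> are regular, \<open>{x, h}\<^sup>e = 1\<close>. Regularity comes from the
  Hall--Petrescu formula, for which sequences are viewed as functions on finite sets.

  Computations take place in a type class of groups; \<open>G\<close>, \<open>\<chi>(G)\<close> and its quotients are moved there
  by their Cayley representations.
\<close>

section \<open>Groups as a type class\<close>

class group_mult = monoid_mult + inverse +
  assumes inverse_mult_self [simp]: "inverse a * a = 1"
    and divide_eq_mult_inverse: "a / b = a * inverse b"
begin

lemma inverse_mult_cancel [simp]: "inverse a * (a * b) = b"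
  by (simp flip: mult.assoc)

lemma mult_left_cancel_iff: "a * b = a * c \<longleftrightarrow> b = c"
  by (metis inverse_mult_cancel)

lemma mult_inverse_self [simp]: "a * inverse a = 1"
  by (metis inverse_mult_cancel mult_1_right inverse_mult_self)

lemma mult_inverse_cancel [simp]: "a * (inverse a * b) = b"
  by (simp flip: mult.assoc)

lemma mult_right_cancel_iff: "b * a = c * a \<longleftrightarrow> b = c"
  by (metis mult.assoc mult_1_right mult_inverse_self)

lemma inverse_inverse_self [simp]: "inverse (inverse a) = a"
  by (metis mult_1_right inverse_mult_self inverse_mult_cancel)

lemma inverse_unit [simp]: "inverse 1 = 1"
  by (metis mult_1_right inverse_mult_self)

lemma inverse_eqI: "a * b = 1 \<Longrightarrow> inverse a = b"
  by (metis mult_1_right inverse_mult_cancel)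

lemma inverse_mult: "inverse (a * b) = inverse b * inverse a"
  by (rule inverse_eqI) (simp add: mult.assoc)

lemmas group_simps = mult.assoc inverse_mult

lemma inverse_power: "inverse (a ^ n) = inverse a ^ n"
  by (induction n) (simp_all add: inverse_mult power_commutes)

lemma conj_power: "(inverse g * x * g) ^ n = inverse g * x ^ n * g"
  by (induction n) (simp_all add: mult.assoc)

lemma commuting_power_mult:
  assumes "a * b = b * a"
  shows "(a * b) ^ n = a ^ n * b ^ n"
proof (induction n)
  case (Suc n)
  have "b * a ^ n = a ^ n * b"
    using assms by (metis power_commuting_commutes)
  then show ?case
    using Suc by (simp add: mult.assoc) (simp flip: mult.assoc)
qed simp

end

section \<open>Commutators and their identities\<close>

definition comm :: "'b \<Rightarrow> 'b \<Rightarrow> 'b::group_mult" where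
  "comm x y = inverse x * inverse y * x * y"

lemma comm_one [simp]: "comm x 1 = 1" "comm 1 x = 1" "comm x x = 1"
  by (simp_all add: comm_def mult.assoc)

lemma inverse_comm: "inverse (comm x y) = comm y x"
  by (simp add: comm_def group_simps)

lemma comm_eq_one_iff: "comm x y = 1 \<longleftrightarrow> x * y = y * x"
proof -
  have "comm x y = inverse (y * x) * (x * y)"
    by (simp add: comm_def group_simps)
  then show ?thesis
    by (metis inverse_mult_cancel mult_1_right inverse_mult_self)
qed

lemma conj_comm: "inverse g * comm x y * g = comm (inverse g * x * g) (inverse g * y * g)"
  by (simp add: comm_def group_simps)

lemma conj_eq_mult_comm: "inverse g * x * g = x * comm x g"
  by (simp add: comm_def group_simps)

lemma comm_mult_left: "comm (a * b) c = inverse b * comm a c * b * comm b c"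
  by (simp add: comm_def group_simps)

lemma comm_mult_right: "comm a (b * c) = comm a c * (inverse c * comm a b * c)"
  by (simp add: comm_def group_simps)

text \<open>Free expansion. It serves the three subgroup argument: if two of the factors lie in a
  normal subgroup, so does the third.\<close>

lemma hall_witt:
  "inverse y * comm (comm x (inverse y)) z * y *
   (inverse z * comm (comm y (inverse z)) x * z) *
   (inverse x * comm (comm z (inverse x)) y * x) = 1"
  by (simp add: comm_def group_simps)

section \<open>Generated subgroups and the lower central series\<close>

definition is_subgroup :: "'b::group_mult set \<Rightarrow> bool" where
  "is_subgroup H \<longleftrightarrow> 1 \<in> H \<and> (\<forall>x\<in>H. \<forall>y\<in>H. x * y \<in> H) \<and> (\<forall>x\<in>H. inverse x \<in> H)"

lemma is_subgroupD:
  assumes "is_subgroup H"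
  shows "1 \<in> H" "x \<in> H \<Longrightarrow> y \<in> H \<Longrightarrow> x * y \<in> H" "x \<in> H \<Longrightarrow> inverse x \<in> H"
    "x \<in> H \<Longrightarrow> y \<in> H \<Longrightarrow> comm x y \<in> H" "x \<in> H \<Longrightarrow> x ^ n \<in> H"
proof -
  show *: "1 \<in> H" "x \<in> H \<Longrightarrow> y \<in> H \<Longrightarrow> x * y \<in> H" "x \<in> H \<Longrightarrow> inverse x \<in> H" for x y
    using assms by (auto simp: is_subgroup_def)
  show "x \<in> H \<Longrightarrow> y \<in> H \<Longrightarrow> comm x y \<in> H"
    by (simp add: comm_def *)
  show "x \<in> H \<Longrightarrow> x ^ n \<in> H"
    by (induction n) (simp_all add: *)
qed

inductive_set gspan :: "'b::group_mult set \<Rightarrow> 'b set" for S where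
  gspan_base: "x \<in> S \<Longrightarrow> x \<in> gspan S"
| gspan_one: "1 \<in> gspan S"
| gspan_mult: "x \<in> gspan S \<Longrightarrow> y \<in> gspan S \<Longrightarrow> x * y \<in> gspan S"
| gspan_inverse: "x \<in> gspan S \<Longrightarrow> inverse x \<in> gspan S"

lemma is_subgroup_gspan: "is_subgroup (gspan S)"
  by (auto simp: is_subgroup_def intro: gspan.intros)

lemma gspan_minimal: "is_subgroup H \<Longrightarrow> S \<subseteq> H \<Longrightarrow> gspan S \<subseteq> H"
proof
  fix x assume H: "is_subgroup H" "S \<subseteq> H" and "x \<in> gspan S"
  from this(3) show "x \<in> H"
    by induction (use H in \<open>auto intro: is_subgroupD\<close>)
qed

lemma gspan_mono: "S \<subseteq> T \<Longrightarrow> gspan S \<subseteq> gspan T"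
  by (intro gspan_minimal is_subgroup_gspan) (auto intro: gspan_base)

text \<open>Normality relative to a subgroup \<open>U\<close>, since the ambient type may contain
  elements outside the group under study.\<close>

definition normalised_by :: "'b::group_mult set \<Rightarrow> 'b set \<Rightarrow> bool" where
  "normalised_by K U \<longleftrightarrow> is_subgroup K \<and> is_subgroup U \<and> (\<forall>k\<in>K. \<forall>u\<in>U. inverse u * k * u \<in> K)"

lemma normalised_byD:
  assumes "normalised_by K U"
  shows "is_subgroup K" "is_subgroup U" "k \<in> K \<Longrightarrow> u \<in> U \<Longrightarrow> inverse u * k * u \<in> K"
    "k \<in> K \<Longrightarrow> u \<in> U \<Longrightarrow> u * k * inverse u \<in> K"
    "k \<in> K \<Longrightarrow> u \<in> U \<Longrightarrow> comm k u \<in> K" "k \<in> K \<Longrightarrow> u \<in> U \<Longrightarrow> comm u k \<in> K"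
proof -
  show sub: "is_subgroup K" "is_subgroup U"
    and *: "k \<in> K \<Longrightarrow> u \<in> U \<Longrightarrow> inverse u * k * u \<in> K" for k u
    using assms by (auto simp: normalised_by_def)
  show "k \<in> K \<Longrightarrow> u \<in> U \<Longrightarrow> u * k * inverse u \<in> K"
    using *[of k "inverse u"] sub(2) by (simp add: is_subgroupD)
  show **: "k \<in> K \<Longrightarrow> u \<in> U \<Longrightarrow> comm k u \<in> K"
    using is_subgroupD(2,3)[OF sub(1)] * by (simp add: comm_def mult.assoc)
  show "k \<in> K \<Longrightarrow> u \<in> U \<Longrightarrow> comm u k \<in> K"
    using is_subgroupD(3)[OF sub(1) **] by (simp add: inverse_comm)
qed

lemma gspan_conj:
  assumes "\<And>x. x \<in> S \<Longrightarrow> inverse g * x * g \<in> gspan S" "x \<in> gspan S"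
  shows "inverse g * x * g \<in> gspan S"
  using assms(2)
proof induction
  case (gspan_mult x y)
  have "inverse g * (x * y) * g = (inverse g * x * g) * (inverse g * y * g)"
    by (simp add: group_simps)
  with gspan_mult show ?case by (simp add: gspan.gspan_mult)
next
  case (gspan_inverse x)
  have "inverse g * inverse x * g = inverse (inverse g * x * g)"
    by (simp add: group_simps)
  with gspan_inverse show ?case by (simp add: gspan.gspan_inverse)
qed (use assms(1) in \<open>auto intro: gspan.intros\<close>)

lemma normalised_by_gspanI:
  assumes "is_subgroup U"
    and "\<And>x u. x \<in> S \<Longrightarrow> u \<in> U \<Longrightarrow> inverse u * x * u \<in> gspan S"
  shows "normalised_by (gspan S) U"
  unfolding normalised_by_def using assms gspan_conj[of S] is_subgroup_gspan by blast

text \<open>Both directions of conjugation are assumed: the generating set \<open>U\<close> need not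
  be closed under inverses, and conjugation may map \<open>K\<close> properly into itself.\<close>

lemma normalised_by_gspanI2:
  assumes K: "is_subgroup K"
    and *: "\<And>k u. k \<in> K \<Longrightarrow> u \<in> U \<Longrightarrow> inverse u * k * u \<in> K"
      "\<And>k u. k \<in> K \<Longrightarrow> u \<in> U \<Longrightarrow> u * k * inverse u \<in> K"
  shows "normalised_by K (gspan U)"
proof -
  have "\<forall>k\<in>K. inverse u * k * u \<in> K \<and> u * k * inverse u \<in> K" if "u \<in> gspan U" for u
    using that
  proof induction
    case (gspan_mult x y)
    have "inverse (x * y) * k * (x * y) = inverse y * (inverse x * k * x) * y"
      "(x * y) * k * inverse (x * y) = x * (y * k * inverse y) * inverse x" for k
      by (simp_all add: group_simps)
    with gspan_mult show ?case by simp
  qed (use * in auto)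
  then show ?thesis
    using K by (auto simp: normalised_by_def is_subgroup_gspan)
qed

lemma normalised_by_self: "is_subgroup H \<Longrightarrow> normalised_by H H"
  by (auto simp: normalised_by_def intro: is_subgroupD)

text \<open>Induction on the generation of \<open>y\<close>, with [x, yz] = [x, z][x, y]^z in the
  product case. Only the second argument has to normalise \<open>K\<close>, so \<open>x\<close> may
  lie outside \<open>U\<close>.\<close>

lemma comm_gspan_right:
  assumes K: "normalised_by K U" and YU: "Y \<subseteq> U"
    and *: "\<And>y. y \<in> Y \<Longrightarrow> comm x y \<in> K" and y: "y \<in> gspan Y"
  shows "comm x y \<in> K"
  using y
proof induction
  case (gspan_mult y z)
  have "z \<in> U" using gspan_mult gspan_minimal[OF normalised_byD(2)[OF K] YU] by blast
  with gspan_mult show ?case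
    unfolding comm_mult_right
    by (intro normalised_byD(3)[OF K] is_subgroupD(2)[OF normalised_byD(1)[OF K]])
next
  case (gspan_inverse y)
  have U: "y \<in> U" using gspan_inverse gspan_minimal[OF normalised_byD(2)[OF K] YU] by blast
  have "comm x (inverse y) = y * inverse (comm x y) * inverse y"
    by (simp add: comm_def group_simps)
  with gspan_inverse U show ?case
    by (simp add: normalised_byD[OF K] is_subgroupD(3)[OF normalised_byD(1)[OF K]])
qed (use * is_subgroupD(1)[OF normalised_byD(1)[OF K]] in auto)

text \<open>The one-sided version is applied twice, the arguments being exchanged by [x, y]^-1 =
  [y, x].\<close>

lemma comm_gspan:
  assumes K: "normalised_by K U" and XU: "X \<subseteq> U" and YU: "Y \<subseteq> U"
    and *: "\<And>x y. x \<in> X \<Longrightarrow> y \<in> Y \<Longrightarrow> comm x y \<in> K"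
    and x: "x \<in> gspan X" and y: "y \<in> gspan Y"
  shows "comm x y \<in> K"
proof -
  note swap = inverse_comm is_subgroupD(3)[OF normalised_byD(1)[OF K]]
  have "comm y x' \<in> K" if "x' \<in> X" for x'
    using comm_gspan_right[OF K YU, of x' y] * that y swap by metis
  then show ?thesis
    using comm_gspan_right[OF K XU, of y x] x swap by metis
qed

section \<open>Mutual commutator subgroups and the lower central series\<close>

definition comm_group :: "'b::group_mult set \<Rightarrow> 'b set \<Rightarrow> 'b set" where
  "comm_group X Y = gspan {comm x y | x y. x \<in> X \<and> y \<in> Y}"

lemma comm_in_comm_group: "x \<in> X \<Longrightarrow> y \<in> Y \<Longrightarrow> comm x y \<in> comm_group X Y"
  unfolding comm_group_def by (rule gspan_base) blast

lemma comm_group_minimal: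
  "is_subgroup H \<Longrightarrow> (\<And>x y. x \<in> X \<Longrightarrow> y \<in> Y \<Longrightarrow> comm x y \<in> H) \<Longrightarrow> comm_group X Y \<subseteq> H"
  unfolding comm_group_def by (rule gspan_minimal) auto

lemma comm_group_mono: "X \<subseteq> X' \<Longrightarrow> Y \<subseteq> Y' \<Longrightarrow> comm_group X Y \<subseteq> comm_group X' Y'"
  unfolding comm_group_def by (rule gspan_mono) blast

lemma normalised_by_comm_group:
  assumes "normalised_by X U" "normalised_by Y U"
  shows "normalised_by (comm_group X Y) U"
  unfolding comm_group_def
proof (rule normalised_by_gspanI)
  fix z u assume "z \<in> {comm x y |x y. x \<in> X \<and> y \<in> Y}" and u: "u \<in> U"
  then obtain x y where xy: "z = comm x y" "x \<in> X" "y \<in> Y" by blast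
  show "inverse u * z * u \<in> gspan {comm x y |x y. x \<in> X \<and> y \<in> Y}"
    unfolding xy(1) conj_comm
    using normalised_byD(3)[OF assms(1) xy(2) u] normalised_byD(3)[OF assms(2) xy(3) u]
    by (blast intro: gspan_base)
qed (rule normalised_byD(2)[OF assms(1)])

text \<open>The usual indexing \<open>\<gamma>\<^sub>1 = H\<close>, with the convention \<open>\<gamma>\<^sub>0 = H\<close>.\<close>

fun gam :: "'b::group_mult set \<Rightarrow> nat \<Rightarrow> 'b set" where
  "gam H 0 = H"
| "gam H (Suc 0) = H"
| "gam H (Suc (Suc n)) = comm_group (gam H (Suc n)) H"

lemma gam_Suc: "n \<ge> 1 \<Longrightarrow> gam H (Suc n) = comm_group (gam H n) H"
  by (cases n) auto

context
  fixes H :: "'b::group_mult set"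
  assumes H: "is_subgroup H"
begin

lemma normalised_by_gam: "normalised_by (gam H n) H"
proof (induction n)
  case (Suc n)
  then show ?case
    using H by (cases n) (simp_all add: normalised_by_comm_group normalised_by_self)
qed (simp add: H normalised_by_self)

lemma is_subgroup_gam: "is_subgroup (gam H n)"
  using normalised_by_gam normalised_byD(1) by blast

lemma gam_Suc_subset: "gam H (Suc n) \<subseteq> gam H n"
proof (cases n)
  case (Suc m)
  then show ?thesis
    by (simp add: comm_group_minimal[OF is_subgroup_gam] normalised_byD(5)[OF normalised_by_gam])
qed simp

lemma gam_antimono: "m \<le> n \<Longrightarrow> gam H n \<subseteq> gam H m"
  by (rule lift_Suc_antimono_le[of "gam H"]) (use gam_Suc_subset in auto)

lemma gam_subset: "gam H n \<subseteq> H"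
  using gam_antimono[of 0 n] by simp

text \<open>The comparison starts at index 2, so that \<open>F 1\<close> need not contain
  \<open>H\<close>; in the applications it does not.\<close>

lemma gam_least:
  assumes "\<And>n. n \<ge> 2 \<Longrightarrow> is_subgroup (F n)" "\<And>x y. x \<in> H \<Longrightarrow> y \<in> H \<Longrightarrow> comm x y \<in> F 2"
    and "\<And>n x y. n \<ge> 2 \<Longrightarrow> x \<in> F n \<Longrightarrow> y \<in> H \<Longrightarrow> comm x y \<in> F (Suc n)"
    and "n \<ge> 2"
  shows "gam H n \<subseteq> F n"
  using assms(4)
proof (induction n rule: dec_induct)
  case base
  show ?case
    using assms(1,2) by (simp add: numeral_2_eq_2 comm_group_minimal)
next
  case (step n)
  then have "comm_group (gam H n) H \<subseteq> F (Suc n)"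
    using assms(1,3) by (intro comm_group_minimal) auto
  with step show ?case by (simp add: gam_Suc)
qed

lemma comm_gam_one: "x \<in> gam H n \<Longrightarrow> h \<in> H \<Longrightarrow> n \<ge> 1 \<Longrightarrow> comm x h \<in> gam H (Suc n)"
  by (simp add: gam_Suc comm_in_comm_group)

text \<open>Induction on \<open>j\<close> by the three subgroup argument: \<gamma>_(j+1) is
  generated by the [b, h], and Hall--Witt expresses a conjugate of [[b, h], x'] by two commutators
  that the induction hypothesis puts into \<gamma>_(i+j+1).\<close>

lemma comm_gam_aux:
  assumes "j \<ge> 1" "i \<ge> 1" "x \<in> gam H i" "y \<in> gam H j"
  shows "comm x y \<in> gam H (i + j)"
  using assms
proof (induction j arbitrary: i x y rule: dec_induct)
  case base
  then show ?case using comm_gam_one by simp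
next
  case (step j)
  let ?K = "gam H (i + Suc j)"
  note K = normalised_by_gam[of "i + Suc j"]
  have "comm x' (comm b h) \<in> ?K" if x': "x' \<in> gam H i" and b: "b \<in> gam H j" and h: "h \<in> H" for x' b h
  proof -
    have xH: "x' \<in> H" and bH: "b \<in> H"
      using gam_subset x' b by auto
    note inv = is_subgroupD(3)[OF H] is_subgroupD(3)[OF is_subgroup_gam]
    have "comm (comm x' (inverse b)) (inverse h) \<in> ?K"
      using comm_gam_one[OF step.IH[OF \<open>i \<ge> 1\<close> x' inv(2)[OF b]] inv(1)[OF h]] step by simp
    then have 1: "inverse b * comm (comm x' (inverse b)) (inverse h) * b \<in> ?K" (is "?u \<in> _")
      by (rule normalised_byD(3)[OF K]) (rule bH)
    have "comm (inverse x') (inverse h) \<in> gam H (Suc i)"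
      by (rule comm_gam_one[OF inv(2)[OF x'] inv(1)[OF h] \<open>i \<ge> 1\<close>])
    then have "comm (inverse h) (inverse x') \<in> gam H (Suc i)"
      using inv(2) inverse_comm by metis
    then have "comm (comm (inverse h) (inverse x')) b \<in> ?K"
      using step.IH[of "Suc i" _ b] b by simp
    then have 2: "inverse x' * comm (comm (inverse h) (inverse x')) b * x' \<in> ?K" (is "?v \<in> _")
      by (rule normalised_byD(3)[OF K]) (rule xH)
    \<comment> \<open>Hall--Witt is taken at \<open>inverse h\<close>, so that its middle factor
      contains [b, h] itself.\<close>
    have "?u * (h * comm (comm b h) x' * inverse h) * ?v = 1"
      using hall_witt[of b x' "inverse h"] by simp
    then have "?u * (h * comm (comm b h) x' * inverse h) = inverse ?v"
      by (metis inverse_eqI inverse_inverse_self)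
    then have "h * comm (comm b h) x' * inverse h = inverse ?u * inverse ?v"
      by (metis inverse_mult_cancel)
    moreover have "inverse ?u * inverse ?v \<in> ?K"
      using is_subgroupD(2,3)[OF is_subgroup_gam] 1 2 by blast
    ultimately have "h * comm (comm b h) x' * inverse h \<in> ?K" by simp
    then have "inverse h * (h * comm (comm b h) x' * inverse h) * h \<in> ?K"
      by (rule normalised_byD(3)[OF K]) (rule h)
    then have "comm (comm b h) x' \<in> ?K" by (simp add: mult.assoc)
    then show ?thesis using inv(2) inverse_comm by metis
  qed
  moreover have "{comm x y |x y. x \<in> gam H j \<and> y \<in> H} \<subseteq> H"
    using is_subgroupD(4)[OF H] gam_subset by auto
  ultimately show ?case
    using step(1) step.prems(3)
      comm_gspan_right[OF K, of "{comm x y |x y. x \<in> gam H j \<and> y \<in> H}" x y] step.prems(2)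
    by (auto simp: gam_Suc comm_group_def)
qed

text \<open>If an index is 0, where \<open>gam\<close> is again \<open>H\<close>, the claim reduces
  to normality of the terms. This case occurs below for the empty index set.\<close>

lemma comm_gam:
  assumes "x \<in> gam H i" "y \<in> gam H j"
  shows "comm x y \<in> gam H (i + j)"
proof -
  have "x \<in> H" "y \<in> H" using gam_subset assms by auto
  then show ?thesis
    using assms comm_gam_aux[of j i x y] normalised_byD(5,6)[OF normalised_by_gam]
      is_subgroupD(4)[OF H]
    by (cases "i = 0"; cases "j = 0") simp_all
qed

end

lemma gam_mono: "H \<subseteq> K \<Longrightarrow> gam H n \<subseteq> gam K n"
  by (induction H n rule: gam.induct) (simp_all add: comm_group_mono)

section \<open>Groups of class less than \<open>p\<close>\<close>

instance "fun" :: (type, group_mult) group_mult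
  by standard (simp_all add: fun_eq_iff divide_eq_mult_inverse)

lemma comm_fun_apply: "comm f g x = comm (f x) (g x)" for f :: "'c \<Rightarrow> 'b::group_mult"
  by (simp add: comm_def)

definition above :: "nat set \<Rightarrow> 'b \<Rightarrow> nat set \<Rightarrow> 'b::group_mult" where
  "above I x = (\<lambda>J. if I \<subseteq> J then x else 1)"

lemma comm_above: "comm (above I x) (above I' y) = above (I \<union> I') (comm x y)"
  by (auto simp: fun_eq_iff comm_fun_apply above_def)

text \<open>A form of the Host--Kra cube group: the upper face of codimension \<open>card I\<close>
  carries entries from the term of the lower central series with that index. The parameter
  \<open>S\<close> keeps only the faces over supersets of \<open>S\<close>.\<close>

definition cubes :: "'b::group_mult set \<Rightarrow> nat set \<Rightarrow> (nat set \<Rightarrow> 'b) set" where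
  "cubes H S = gspan {above I x |I x. finite I \<and> S \<subseteq> I \<and> x \<in> gam H (card I)}"

lemma is_subgroup_cubes: "is_subgroup (cubes H S)"
  unfolding cubes_def by (rule is_subgroup_gspan)

lemma above_in_cubes: "finite I \<Longrightarrow> S \<subseteq> I \<Longrightarrow> x \<in> gam H (card I) \<Longrightarrow> above I x \<in> cubes H S"
  unfolding cubes_def by (rule gspan_base) blast

lemma cubes_mono: "S' \<subseteq> S \<Longrightarrow> cubes H S \<subseteq> cubes H S'"
  unfolding cubes_def by (intro gspan_mono) blast

context
  fixes H :: "'b::group_mult set"
  assumes H: "is_subgroup H"
begin

text \<open>A commutator of two faces is supported on the face of I \<union> I', and card (I
  \<union> I') \<le> card I + card I' keeps its entry [x, y] in the required term.\<close>

lemma normalised_by_cubes: "normalised_by (cubes H S) (cubes H {})"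
proof -
  have *: "comm k u \<in> cubes H S"
    if k: "k \<in> {above I x |I x. finite I \<and> S \<subseteq> I \<and> x \<in> gam H (card I)}"
      and u: "u \<in> {above I x |I x. finite I \<and> {} \<subseteq> I \<and> x \<in> gam H (card I)}" for k u
  proof -
    obtain I x where I: "k = above I x" "finite I" "S \<subseteq> I" "x \<in> gam H (card I)"
      using k by blast
    obtain I' y where I': "u = above I' y" "finite I'" "y \<in> gam H (card I')"
      using u by blast
    have "comm x y \<in> gam H (card (I \<union> I'))"
      using comm_gam[OF H I(4) I'(3)] gam_antimono[OF H card_Un_le[of I I']] by blast
    then show ?thesis
      unfolding I(1) I'(1) comm_above using I I' by (intro above_in_cubes) auto
  qed
  have inv: "inverse u \<in> {above I x |I x. finite I \<and> {} \<subseteq> I \<and> x \<in> gam H (card I)}"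
    if u: "u \<in> {above I x |I x. finite I \<and> {} \<subseteq> I \<and> x \<in> gam H (card I)}" for u
  proof -
    obtain I x where I: "u = above I x" "finite I" "x \<in> gam H (card I)"
      using u by blast
    then have "inverse u = above I (inverse x)" "inverse x \<in> gam H (card I)"
      by (auto simp: fun_eq_iff above_def is_subgroupD(3)[OF is_subgroup_gam[OF H]])
    with I show ?thesis by blast
  qed
  have conj: "inverse u * k * u \<in> cubes H S"
    if k: "k \<in> cubes H S"
      and u: "u \<in> {above I x |I x. finite I \<and> {} \<subseteq> I \<and> x \<in> gam H (card I)}" for k u
    unfolding cubes_def
  proof (rule gspan_conj[OF _ k[unfolded cubes_def]])
    fix x assume x: "x \<in> {above I x |I x. finite I \<and> S \<subseteq> I \<and> x \<in> gam H (card I)}"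
    then have "x \<in> cubes H S" by (simp add: cubes_def gspan_base)
    then have "inverse u * x * u \<in> cubes H S"
      unfolding conj_eq_mult_comm by (rule is_subgroupD(2)[OF is_subgroup_cubes _ *[OF x u]])
    then show "inverse u * x * u \<in> gspan {above I x |I x. finite I \<and> S \<subseteq> I \<and> x \<in> gam H (card I)}"
      unfolding cubes_def .
  qed
  show ?thesis
    unfolding cubes_def[of H "{}"]
  proof (rule normalised_by_gspanI2[OF is_subgroup_cubes])
    fix k u
    assume k: "k \<in> cubes H S"
      and u: "u \<in> {above I x |I x. finite I \<and> {} \<subseteq> I \<and> x \<in> gam H (card I)}"
    show "inverse u * k * u \<in> cubes H S" by (rule conj[OF k u])
    show "u * k * inverse u \<in> cubes H S"
      using conj[OF k inv[OF u]] by (simp only: inverse_inverse_self)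
  qed
qed

text \<open>Comparing \<open>f\<close> with its restriction away from \<open>i\<close> kills every generator
  whose support condition does not involve \<open>i\<close>.\<close>

lemma cubes_deriv:
  assumes "f \<in> cubes H S"
  shows "inverse (\<lambda>J. f (J - {i})) * f \<in> cubes H (insert i S)"
proof -
  define \<rho> :: "(nat set \<Rightarrow> 'b) \<Rightarrow> nat set \<Rightarrow> 'b" where "\<rho> f = (\<lambda>J. f (J - {i}))" for f
  have \<rho>: "\<rho> (f * g) = \<rho> f * \<rho> g" "\<rho> (inverse f) = inverse (\<rho> f)" "\<rho> 1 = 1" for f g
    by (simp_all add: \<rho>_def fun_eq_iff)
  have \<rho>_above: "\<rho> (above I x) = (if i \<in> I then 1 else above I x)" for I x
    by (auto simp: \<rho>_def above_def fun_eq_iff)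
  note sub = is_subgroupD[OF is_subgroup_cubes]
  have \<rho>_in: "\<rho> f \<in> cubes H {}" if "f \<in> cubes H S" for f
    using that unfolding cubes_def[of H S]
  proof induction
    case (gspan_base f)
    then show ?case by (auto simp: \<rho>_above sub intro: above_in_cubes)
  next
    case gspan_one
    show ?case unfolding \<rho>(3) by (rule sub(1))
  next
    case (gspan_mult f g)
    show ?case unfolding \<rho>(1) by (rule sub(2)) (fact gspan_mult.IH)+
  next
    case (gspan_inverse f)
    show ?case unfolding \<rho>(2) by (rule sub(3)) (fact gspan_inverse.IH)
  qed
  have S: "cubes H S \<subseteq> cubes H {}" by (rule cubes_mono) simp
  have "inverse (\<rho> f) * f \<in> cubes H (insert i S)"
    using assms unfolding cubes_def[of H S]
  proof induction
    case (gspan_base f)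
    then obtain I x where I: "f = above I x" "finite I" "S \<subseteq> I" "x \<in> gam H (card I)"
      by blast
    show ?case
    proof (cases "i \<in> I")
      case True
      then have "inverse (\<rho> f) * f = above I x"
        unfolding I(1) \<rho>_above by (simp only: if_True inverse_unit mult_1_left)
      then show ?thesis using True I by (simp only:) (intro above_in_cubes, auto)
    next
      case False
      then have "inverse (\<rho> f) * f = 1"
        unfolding I(1) \<rho>_above by (simp only: if_False inverse_mult_self)
      then show ?thesis by (simp only: sub(1))
    qed
  next
    case (gspan_mult f g)
    \<comment> \<open>The expression is not multiplicative in \<open>f\<close>: a product brings in
      conjugation by \<open>\<rho> g\<close>, hence the appeal to normality.\<close>
    have "inverse (\<rho> (f * g)) * (f * g) =
        (inverse (\<rho> g) * (inverse (\<rho> f) * f) * \<rho> g) * (inverse (\<rho> g) * g)"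
      unfolding \<rho> by (simp only: group_simps mult_inverse_cancel)
    moreover have "\<rho> g \<in> cubes H {}"
      using gspan_mult(2) by (intro \<rho>_in) (simp only: cubes_def)
    ultimately show ?case
      using sub(2)[OF normalised_byD(3)[OF normalised_by_cubes gspan_mult.IH(1)] gspan_mult.IH(2)]
      by (simp only:)
  next
    case (gspan_inverse f)
    have "inverse (\<rho> (inverse f)) * inverse f = f * inverse (inverse (\<rho> f) * f) * inverse f"
      unfolding \<rho> by (simp only: group_simps mult_inverse_cancel inverse_inverse_self)
    moreover have "f \<in> cubes H {}"
      using gspan_inverse(1) S by (auto simp only: cubes_def)
    ultimately show ?case
      using normalised_byD(4)[OF normalised_by_cubes sub(3)[OF gspan_inverse.IH]]
      by (simp only:)
  next
    case gspan_one
    show ?case unfolding \<rho> by (simp only: inverse_unit mult_1_left sub(1))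
  qed
  then show ?thesis by (simp only: \<rho>_def)
qed

text \<open>Taking derivatives in all directions of \<omega> leaves the values on subsets of
  \<omega> unchanged, as those on proper subsets are trivial, and leads to
  \<open>cubes H \<omega>\<close>. There only faces with I = \<omega> contribute to the value at
  \<omega>.\<close>

lemma cubes_top:
  assumes f: "f \<in> cubes H {}" and \<omega>: "finite \<omega>" and "\<And>J. J \<subset> \<omega> \<Longrightarrow> f J = 1"
  shows "f \<omega> \<in> gam H (card \<omega>)"
proof -
  have "\<exists>g\<in>cubes H S. \<forall>J\<subseteq>\<omega>. g J = f J" if "finite S" "S \<subseteq> \<omega>" for S
    using that
  proof induction
    case (insert i S)
    then obtain g where g: "g \<in> cubes H S" "\<forall>J\<subseteq>\<omega>. g J = f J" by auto
    have "g (J - {i}) = 1" if "J \<subseteq> \<omega>" for J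
    proof -
      have "J - {i} \<subset> \<omega>" using that insert by auto
      then show ?thesis using g assms(3) by auto
    qed
    then show ?case
      using g cubes_deriv[OF g(1), of i] by (intro bexI[OF _ cubes_deriv[OF g(1)]]) auto
  qed (use f in auto)
  then obtain g where g: "g \<in> cubes H \<omega>" "\<forall>J\<subseteq>\<omega>. g J = f J"
    using \<omega> by blast
  note sub = is_subgroupD[OF is_subgroup_gam[OF H]]
  have "g \<omega> \<in> gam H (card \<omega>)"
    using g(1) unfolding cubes_def
    by induction (auto simp: above_def sub)
  with g show ?thesis by auto
qed

text \<open>The set-indexed function is allowed to depend only on \<open>card J\<close>, truncated to \<open>{..<N}\<close> so that
  it involves finitely many generators.\<close>

definition hall_seqs :: "(nat \<Rightarrow> 'b) set" where
  "hall_seqs = {F. \<forall>N. (\<lambda>J. F (card (J \<inter> {..<N}))) \<in> cubes H {}}"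

lemma hall_seqs_mult: "F \<in> hall_seqs \<Longrightarrow> F' \<in> hall_seqs \<Longrightarrow> (\<lambda>n. F n * F' n) \<in> hall_seqs"
  unfolding hall_seqs_def mem_Collect_eq
proof
  fix N
  assume "\<forall>N. (\<lambda>J. F (card (J \<inter> {..<N}))) \<in> cubes H {}" "\<forall>N. (\<lambda>J. F' (card (J \<inter> {..<N}))) \<in> cubes H {}"
  then have "(\<lambda>J. F (card (J \<inter> {..<N}))) * (\<lambda>J. F' (card (J \<inter> {..<N}))) \<in> cubes H {}"
    using is_subgroupD(2)[OF is_subgroup_cubes] by blast
  then show "(\<lambda>J. F (card (J \<inter> {..<N})) * F' (card (J \<inter> {..<N}))) \<in> cubes H {}"
    by (simp add: times_fun_def)
qed

lemma hall_seqs_inverse: "F \<in> hall_seqs \<Longrightarrow> (\<lambda>n. inverse (F n)) \<in> hall_seqs"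
  unfolding hall_seqs_def mem_Collect_eq
proof
  fix N
  assume "\<forall>N. (\<lambda>J. F (card (J \<inter> {..<N}))) \<in> cubes H {}"
  then have "inverse (\<lambda>J. F (card (J \<inter> {..<N}))) \<in> cubes H {}"
    using is_subgroupD(3)[OF is_subgroup_cubes] by blast
  then show "(\<lambda>J. inverse (F (card (J \<inter> {..<N})))) \<in> cubes H {}"
    by (simp add: inverse_fun_def o_def)
qed

text \<open>The binomial coefficient counts the k-subsets of an n-set, so the truncated function is
  the product of the faces \<open>above I c\<close> over the k-subsets I of {..<N}.\<close>

lemma hall_seqs_binomial:
  assumes c: "c \<in> gam H k"
  shows "(\<lambda>n. c ^ (n choose k)) \<in> hall_seqs"
  unfolding hall_seqs_def
proof (intro CollectI allI)
  fix N :: nat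
  have *: "(\<lambda>J. c ^ card {I \<in> F. I \<subseteq> J}) \<in> cubes H {}"
    if "finite F" "F \<subseteq> {I. finite I \<and> card I = k}" for F
    using that
  proof induction
    case empty
    then show ?case
      using is_subgroupD(1)[OF is_subgroup_cubes] by (simp add: one_fun_def)
  next
    case (insert I F)
    have "c ^ card {I' \<in> insert I F. I' \<subseteq> J} = above I c J * c ^ card {I \<in> F. I \<subseteq> J}" for J
    proof -
      have "{I' \<in> insert I F. I' \<subseteq> J} = (if I \<subseteq> J then insert I {I \<in> F. I \<subseteq> J} else {I \<in> F. I \<subseteq> J})"
        by auto
      then show ?thesis using insert by (simp add: above_def)
    qed
    then have "(\<lambda>J. c ^ card {I' \<in> insert I F. I' \<subseteq> J}) = above I c * (\<lambda>J. c ^ card {I \<in> F. I \<subseteq> J})"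
      by (simp add: fun_eq_iff)
    then show ?case
      using insert c by (auto intro!: is_subgroupD(2)[OF is_subgroup_cubes] above_in_cubes)
  qed
  have "card {I \<in> {I. I \<subseteq> {..<N} \<and> card I = k}. I \<subseteq> J} = (card (J \<inter> {..<N}) choose k)" for J
  proof -
    have "{I \<in> {I. I \<subseteq> {..<N} \<and> card I = k}. I \<subseteq> J} = {I. I \<subseteq> J \<inter> {..<N} \<and> card I = k}"
      by auto
    then show ?thesis by (simp only: n_subsets finite_Int finite_lessThan disj_absorb simp_thms)
  qed
  moreover have "finite {I. I \<subseteq> {..<N} \<and> card I = k}"
    "{I. I \<subseteq> {..<N} \<and> card I = k} \<subseteq> {I. finite I \<and> card I = k}"
    by (auto intro: finite_subset)
  ultimately show "(\<lambda>J. c ^ (card (J \<inter> {..<N}) choose k)) \<in> cubes H {}"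
    using *[of "{I. I \<subseteq> {..<N} \<and> card I = k}"] by (simp only:)
qed

lemma hall_seqs_top:
  assumes F: "F \<in> hall_seqs" and "\<And>n. n < k \<Longrightarrow> F n = 1"
  shows "F k \<in> gam H k"
proof -
  have "F (card ({..<k} \<inter> {..<k})) \<in> gam H (card {..<k})"
  proof (rule cubes_top[where f = "\<lambda>J. F (card (J \<inter> {..<k}))" and \<omega> = "{..<k}"])
    show "(\<lambda>J. F (card (J \<inter> {..<k}))) \<in> cubes H {}"
      using F by (simp add: hall_seqs_def)
  next
    fix J assume J: "J \<subset> {..<k}"
    then have "card (J \<inter> {..<k}) < card {..<k}"
      by (intro psubset_card_mono) auto
    with assms(2) show "F (card (J \<inter> {..<k})) = 1" by simp
  qed simp
  then show ?thesis by simp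
qed

text \<open>By strong induction all values before \<open>F n\<close> are trivial, so
  \<open>F n\<close> lies in \<gamma>_n, which is trivial from \<open>k\<close> on.\<close>

lemma hall_seqs_vanish:
  assumes F: "F \<in> hall_seqs" and k: "gam H k \<subseteq> {1}" "\<And>n. n < k \<Longrightarrow> F n = 1"
  shows "F n = 1"
proof (induction n rule: less_induct)
  case (less n)
  show ?case
  proof (cases "n < k")
    case False
    have "F n \<in> gam H n" using hall_seqs_top[OF F] less by blast
    then show ?thesis using False k(1) gam_antimono[OF H, of k n] by auto
  qed (use k in auto)
qed

lemma prime_power_dvd_binomial:
  assumes "prime p" "0 < k" "k < p"
  shows "p ^ r dvd (p ^ r choose k)"
proof -
  have "p ^ r dvd k * (p ^ r choose k)"
    using times_binomial_minus1_eq[OF assms(2), of "p ^ r"] by simp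
  moreover have "coprime (p ^ r) k"
    using assms by (simp add: prime_imp_coprime nat_dvd_not_less)
  ultimately show ?thesis by (simp add: coprime_dvd_mult_right_iff)
qed

text \<open>Hall--Petrescu at n = p^r. For k = 2, ..., p - 1 the leading value c = F k is stripped
  off as the factor c^(n choose k), which is trivial at p^r since p^r divides the binomial
  coefficient. What remains at k = p vanishes.\<close>

lemma hall_seqs_prime_power:
  assumes p: "prime p" and H2: "\<And>x. x \<in> gam H 2 \<Longrightarrow> x ^ p ^ r = 1" and Hp: "gam H p \<subseteq> {1}"
    and F: "F \<in> hall_seqs" and F01: "F 0 = 1" "F 1 = 1"
  shows "F (p ^ r) = 1"
proof -
  have "F (p ^ r) = 1"
    if "F \<in> hall_seqs" "\<And>n. n < k \<Longrightarrow> F n = 1" "2 \<le> k" "k \<le> p" for F k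
    using \<open>k \<le> p\<close> that(1-3)
  proof (induction k arbitrary: F rule: inc_induct)
    case base
    then show ?case using hall_seqs_vanish[OF _ Hp] by blast
  next
    case (step k)
    define c where "c = F k"
    have c: "c \<in> gam H k"
      unfolding c_def using step.prems by (intro hall_seqs_top)
    define F' where "F' = (\<lambda>n. inverse (c ^ (n choose k)) * F n)"
    have "F' (p ^ r) = 1"
    proof (rule step.IH)
      show "F' \<in> hall_seqs"
        unfolding F'_def using step.prems c
        by (intro hall_seqs_mult hall_seqs_inverse hall_seqs_binomial)
      fix n assume "n < Suc k"
      then show "F' n = 1"
        using step.prems(2) by (cases "n = k") (simp_all add: F'_def c_def binomial_eq_0)
    qed (use step in auto)
    moreover have "c ^ (p ^ r choose k) = 1"
    proof -
      obtain q where "(p ^ r choose k) = p ^ r * q"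
        using prime_power_dvd_binomial[OF p, of k r] step by (auto elim: dvdE)
      moreover have "c ^ p ^ r = 1"
        using c H2 gam_antimono[OF H, of 2 k] step by auto
      ultimately show ?thesis by (simp add: power_mult)
    qed
    ultimately show ?case by (simp add: F'_def)
  qed
  moreover have "2 \<le> p" using p by (rule prime_ge_2_nat)
  moreover have "F n = 1" if "n < 2" for n
    using that F01 less_2_cases[OF that] by auto
  ultimately show ?thesis using F by blast
qed

lemma power_sequence_in_hall_seqs: "a \<in> H \<Longrightarrow> (\<lambda>n. a ^ n) \<in> hall_seqs"
  using hall_seqs_binomial[of a 1] by simp

text \<open>The sequence (a^n b^n)^-1 (ab)^n is trivial at 0 and 1, so the exponent hypothesis
  concerns \<gamma>_2 only.\<close>

lemma power_mult_prime_power: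
  assumes p: "prime p" and H2: "\<And>x. x \<in> gam H 2 \<Longrightarrow> x ^ p ^ r = 1" and Hp: "gam H p \<subseteq> {1}"
    and ab: "a \<in> H" "b \<in> H"
  shows "(a * b) ^ p ^ r = a ^ p ^ r * b ^ p ^ r"
proof -
  define F where "F = (\<lambda>n. inverse (a ^ n * b ^ n) * (a * b) ^ n)"
  have "F \<in> hall_seqs"
    unfolding F_def using ab is_subgroupD(2)[OF H ab]
    by (intro hall_seqs_mult hall_seqs_inverse power_sequence_in_hall_seqs)
  moreover have "F 0 = 1" "F 1 = 1"
    by (simp_all add: F_def)
  ultimately have "F (p ^ r) = 1"
    using hall_seqs_prime_power[OF p H2 Hp] by blast
  then have "inverse (a ^ p ^ r * b ^ p ^ r) * (a * b) ^ p ^ r =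
      inverse (a ^ p ^ r * b ^ p ^ r) * (a ^ p ^ r * b ^ p ^ r)"
    unfolding F_def by simp
  then show ?thesis
    by (simp only: mult_left_cancel_iff)
qed

end

section \<open>Products of elements of order dividing p^r in class less than p\<close>

lemma gam_pair_shift:
  fixes H :: "'b::group_mult set"
  assumes H: "is_subgroup H" and x: "x \<in> H" and n: "n \<ge> 2"
  shows "gam (gspan (insert x (gam H 2))) n \<subseteq> gam H (Suc n)"
proof (rule gam_least[where F = "\<lambda>n. gam H (Suc n)"])
  note K = normalised_by_gam[OF H]
  show "is_subgroup (gspan (insert x (gam H 2)))" by (rule is_subgroup_gspan)
  show "is_subgroup (gam H (Suc n))" for n by (rule is_subgroup_gam[OF H])
  have L: "gspan (insert x (gam H 2)) \<subseteq> H"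
    using x gam_subset[OF H] by (intro gspan_minimal H) auto
  have sub: "insert x (gam H 2) \<subseteq> H" using x gam_subset[OF H] by blast
  have inv: "comm u v \<in> gam H n" if "comm v u \<in> gam H n" for u v n
    using that is_subgroupD(3)[OF is_subgroup_gam[OF H]] inverse_comm by metis
  show "comm u v \<in> gam H (Suc 2)"
    if u: "u \<in> gspan (insert x (gam H 2))" and v: "v \<in> gspan (insert x (gam H 2))" for u v
  proof (rule comm_gspan[OF K sub sub _ u v])
    \<comment> \<open>The only commutator of generators without an entry from \<open>gam H 2\<close>
      is [x, x] = 1; this gains one step in the series.\<close>
    fix u v assume uv: "u \<in> insert x (gam H 2)" "v \<in> insert x (gam H 2)"
    then have "u \<in> H" "v \<in> H" using sub by auto
    then have "comm u' v \<in> gam H (Suc 2)" "comm u v' \<in> gam H (Suc 2)"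
      if "u' \<in> gam H 2" "v' \<in> gam H 2" for u' v'
      using comm_gam_one[OF H, of _ 2] that inv by auto
    with uv show "comm u v \<in> gam H (Suc 2)"
      by (auto simp: is_subgroupD(1)[OF is_subgroup_gam[OF H]])
  qed
  show "comm u v \<in> gam H (Suc (Suc n))"
    if "n \<ge> 2" "u \<in> gam H (Suc n)" "v \<in> gspan (insert x (gam H 2))" for n u v
    using that L comm_gam_one[OF H, of u "Suc n" v] by auto
qed (use n in auto)

text \<open>With \<open>H = \<langle>a, b\<rangle>\<close>, the group \<open>\<langle>a\<rangle>\<gamma>\<^sub>2(H)\<close> has smaller class; it contains \<open>[a, b] = a\<^bsup>-1\<^esup>a\<^bsup>b\<^esup>\<close>,
  whose conjugates generate \<open>\<gamma>\<^sub>2(H)\<close>. So by induction \<open>\<gamma>\<^sub>2(H)\<close> has exponent dividing \<open>p\<^sup>r\<close>.\<close>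

lemma power_mult_eq_one_aux:
  fixes a b :: "'b::group_mult"
  assumes p: "prime p" and "Suc s \<le> p" "gam (gspan {a, b}) (Suc s) \<subseteq> {1}"
    and "a ^ p ^ r = 1" "b ^ p ^ r = 1"
  shows "(a * b) ^ p ^ r = 1"
  using assms(2-)
proof (induction s arbitrary: a b)
  case 0
  then have "a = 1" "b = 1" by (auto intro: gspan_base)
  then show ?case by simp
next
  case (Suc s)
  define H where "H = gspan {a, b}"
  have H: "is_subgroup H" by (simp add: H_def is_subgroup_gspan)
  have ab: "a \<in> H" "b \<in> H" by (auto simp: H_def intro: gspan_base)
  note sub = is_subgroupD[OF H]
  have Hs: "gam H (Suc (Suc s)) \<subseteq> {1}" using Suc.prems(2) by (simp add: H_def)
  show ?case
  \<comment> \<open>\<open>gam_pair_shift\<close> starts at index 2, so the abelian case is treated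
    separately.\<close>
  proof (cases "s = 0")
    case True
    then have "comm a b = 1"
      using Hs ab comm_in_comm_group[of a H b H] by auto
    then show ?thesis
      using Suc.prems by (simp add: commuting_power_mult comm_eq_one_iff)
  next
    case False
    let ?L = "gspan (insert a (gam H 2))"
    have L: "gam ?L (Suc s) \<subseteq> {1}"
      using gam_pair_shift[OF H ab(1), of "Suc s"] Hs False by auto
    have IH: "(u * v) ^ p ^ r = 1"
      if "u \<in> ?L" "v \<in> ?L" "u ^ p ^ r = 1" "v ^ p ^ r = 1" for u v
    proof (rule Suc.IH)
      have "gspan {u, v} \<subseteq> ?L" using that by (intro gspan_minimal is_subgroup_gspan) auto
      then show "gam (gspan {u, v}) (Suc s) \<subseteq> {1}" using gam_mono L by blast
    qed (use that Suc.prems in auto)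
    have L2: "gam H 2 \<subseteq> ?L" by (auto intro: gspan_base)
    have H2: "comm x y \<in> gam H 2" if "x \<in> H" "y \<in> H" for x y
      using that comm_in_comm_group by (auto simp: numeral_2_eq_2)
    have "comm a b ^ p ^ r = 1"
    proof -
      have "inverse b * a * b \<in> ?L"
        unfolding conj_eq_mult_comm using H2[OF ab] L2 by (auto intro: gspan.intros)
      then have "(inverse a * (inverse b * a * b)) ^ p ^ r = 1"
        using IH[of "inverse a" "inverse b * a * b"] Suc.prems
          gspan_inverse[OF gspan_base[of a "insert a (gam H 2)"]]
        by (simp add: conj_power flip: inverse_power)
      then show ?thesis by (simp add: comm_def mult.assoc)
    qed
    define S where "S = {inverse h * comm a b * h |h. h \<in> H}"
    have "S \<subseteq> gam H 2"
      using H2[OF ab] normalised_byD(3)[OF normalised_by_gam[OF H]] by (auto simp: S_def)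
    then have SL: "gspan S \<subseteq> gam H 2"
      by (rule gspan_minimal[OF is_subgroup_gam[OF H]])
    have Sexp: "x ^ p ^ r = 1" if "x \<in> gspan S" for x
      using that
    proof induction
      case (gspan_base x)
      then show ?case using \<open>comm a b ^ p ^ r = 1\<close> by (auto simp: S_def conj_power)
    next
      case (gspan_mult x y)
      then show ?case using IH SL L2 by blast
    qed (simp_all flip: inverse_power)
    have S_H: "normalised_by (gspan S) H"
    proof (rule normalised_by_gspanI[OF H])
      fix x u assume x: "x \<in> S" and u: "u \<in> H"
      then obtain h where h: "h \<in> H" "x = inverse h * comm a b * h" by (auto simp: S_def)
      have "inverse u * x * u = inverse (h * u) * comm a b * (h * u)"
        by (simp add: h group_simps)
      with u h sub(2) show "inverse u * x * u \<in> gspan S"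
        by (auto simp: S_def intro!: gspan_base)
    qed
    have "gam H 2 \<subseteq> gspan S"
      unfolding numeral_2_eq_2 gam.simps
    proof (rule comm_group_minimal[OF is_subgroup_gspan])
      fix x y assume "x \<in> H" "y \<in> H"
      have "1 * comm a b * 1 \<in> S" using sub(1) by (force simp: S_def)
      then have "comm a b \<in> gspan S" by (simp add: gspan_base)
      then have *: "comm u v \<in> gspan S" if "u \<in> {a, b}" "v \<in> {a, b}" for u v
        using that gspan_one[of S] gspan_inverse[of "comm a b" S] by (auto simp: inverse_comm)
      show "comm x y \<in> gspan S"
      proof (rule comm_gspan[OF S_H _ _ *])
        show "{a, b} \<subseteq> H" "{a, b} \<subseteq> H" using ab by auto
        show "x \<in> gspan {a, b}" "y \<in> gspan {a, b}"
          using \<open>x \<in> H\<close> \<open>y \<in> H\<close> by (simp_all only: H_def)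
      qed
    qed
    then have "x ^ p ^ r = 1" if "x \<in> gam H 2" for x
      using Sexp that by blast
    moreover have "gam H p \<subseteq> {1}"
      using Hs gam_antimono[OF H Suc.prems(1)] by blast
    ultimately have "(a * b) ^ p ^ r = a ^ p ^ r * b ^ p ^ r"
      using power_mult_prime_power[OF H p _ _ ab] by blast
    then show ?thesis using Suc.prems by simp
  qed
qed

lemma power_mult_eq_one:
  fixes a b :: "'b::group_mult"
  assumes p: "prime p" and "gam (gspan {a, b}) p \<subseteq> {1}" "a ^ p ^ r = 1" "b ^ p ^ r = 1"
  shows "(a * b) ^ p ^ r = 1"
  using power_mult_eq_one_aux[OF p, of "p - 1" a b r] assms prime_gt_0_nat[OF p] by simp

lemma gspan_exponent:
  fixes S :: "'b::group_mult set"
  assumes p: "prime p" and Sp: "gam (gspan S) p \<subseteq> {1}" and S: "\<And>x. x \<in> S \<Longrightarrow> x ^ p ^ r = 1"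
    and "x \<in> gspan S"
  shows "x ^ p ^ r = 1"
  using assms(4)
proof induction
  case (gspan_mult x y)
  have "gspan {x, y} \<subseteq> gspan S"
    using gspan_mult by (intro gspan_minimal is_subgroup_gspan) auto
  then have "gam (gspan {x, y}) p \<subseteq> {1}" using gam_mono Sp by blast
  with gspan_mult p show ?case by (simp add: power_mult_eq_one)
qed (simp_all add: S flip: inverse_power)

section \<open>Powers when a commutator commutes with its entries\<close>

lemma comm_power_eq_one:
  fixes a b :: "'b::group_mult"
  assumes a: "a ^ e = 1" and "comm b a * a = a * comm b a"
  shows "comm b a ^ e = 1"
proof -
  \<comment> \<open>[b, a] a^-1 is a conjugate of a^-1, so its e-th power is trivial.\<close>
  have "(comm b a * inverse a) ^ e = comm b a ^ e * inverse a ^ e"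
  proof (rule commuting_power_mult)
    show "comm b a * inverse a = inverse a * comm b a"
      using assms(2) by (metis mult.assoc mult_inverse_cancel mult_inverse_self mult_1_right inverse_mult_cancel)
  qed
  moreover have "comm b a * inverse a = inverse b * inverse a * b"
    by (simp add: comm_def mult.assoc)
  ultimately show ?thesis
    using a by (simp add: conj_power flip: inverse_power)
qed

lemma power_mult_class_two:
  fixes a b :: "'b::group_mult"
  assumes a: "comm b a * a = a * comm b a" and b: "comm b a * b = b * comm b a"
  shows "(a * b) ^ n = a ^ n * b ^ n * comm b a ^ (n choose 2)"
proof (induction n)
  case (Suc n)
  define z where "z = comm b a"
  have za: "z ^ m * a = a * z ^ m" and zb: "z ^ m * b = b * z ^ m" for m
    using a b by (simp_all add: z_def power_commuting_commutes)
  have ba: "b * a = a * b * z"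
    by (simp add: z_def comm_def mult.assoc)
  have bna: "b ^ n * a = a * b ^ n * z ^ n"
  proof (induction n)
    case (Suc n)
    have "b ^ Suc n * a = b * (b ^ n * a)" by (simp add: mult.assoc)
    also have "\<dots> = (b * a) * b ^ n * z ^ n" by (simp add: Suc mult.assoc)
    also have "\<dots> = a * b * (z * b ^ n) * z ^ n" by (simp add: ba mult.assoc)
    also have "z * b ^ n = b ^ n * z"
      using zb[of 1] by (metis power_commuting_commutes power_one_right)
    finally show ?case by (simp add: mult.assoc)
  qed simp
  have "(a * b) ^ Suc n = a ^ n * b ^ n * (z ^ (n choose 2) * a) * b"
    using Suc by (simp add: z_def power_commutes mult.assoc power_Suc2 del: power_Suc)
  also have "\<dots> = a ^ n * (b ^ n * a) * (z ^ (n choose 2) * b)"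
    by (simp add: za mult.assoc)
  also have "\<dots> = a ^ n * a * b ^ n * (z ^ n * b) * z ^ (n choose 2)"
    unfolding bna zb[of "n choose 2"] by (simp add: mult.assoc)
  also have "\<dots> = a ^ Suc n * b ^ Suc n * z ^ (n + (n choose 2))"
    unfolding zb by (simp add: mult.assoc power_add power_Suc2 del: power_Suc)
  also have "n + (n choose 2) = Suc n choose 2"
    by (simp add: numeral_2_eq_2)
  finally show ?case by (simp add: z_def)
qed (simp add: binomial_eq_0)

text \<open>The factor 2 makes \<open>e\<close> divide the binomial coefficient (2e choose 2) = e(2e
  - 1). It is the source of the power of 2 in the bound for p = 2.\<close>

lemma power_mult_eq_one_class_two:
  fixes a b :: "'b::group_mult"
  assumes "comm b a * a = a * comm b a" "comm b a * b = b * comm b a"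
    and "comm b a ^ e = 1" "a ^ (2 * e) = 1" "b ^ (2 * e) = 1"
  shows "(a * b) ^ (2 * e) = 1"
proof -
  have "comm b a ^ (2 * e choose 2) = (comm b a ^ e) ^ (2 * e - 1)"
    by (simp add: choose_two mult.assoc flip: power_mult)
  then show ?thesis
    using assms by (simp only: power_mult_class_two power_one mult_1_left)
qed

lemma conj_eq_self_iff: "inverse c * d * c = d \<longleftrightarrow> c * d = d * c" for c d :: "'b::group_mult"
  using mult_left_cancel_iff[of c "inverse c * d * c" d] by (auto simp: mult.assoc)

lemma commute_inverse:
  fixes c d :: "'b::group_mult"
  assumes "inverse c * d = d * inverse c"
  shows "d * c = c * d"
proof -
  have "c * (inverse c * d) * c = c * (d * inverse c) * c" by (simp only: assms)
  then show ?thesis by (simp add: mult.assoc)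
qed

text \<open>With the trivial subgroup as target, the lemmas on commutators of spans become
  statements about commuting elements.\<close>

lemma normalised_by_one: "normalised_by {1} UNIV"
  by (simp add: normalised_by_def is_subgroup_def)

section \<open>Weakly commuting copies of a group\<close>

text \<open>Stated for homomorphisms \<open>i\<close> and \<open>j\<close> into any group, so that
  it covers \<chi>(G) as well as its quotients by the subgroups \<open>M q\<close>.\<close>

locale weak_comm =
  fixes A :: "'g::group_mult set" and i j :: "'g \<Rightarrow> 'b::group_mult"
  assumes A: "is_subgroup A"
    and i_mult: "x \<in> A \<Longrightarrow> y \<in> A \<Longrightarrow> i (x * y) = i x * i y"
    and j_mult: "x \<in> A \<Longrightarrow> y \<in> A \<Longrightarrow> j (x * y) = j x * j y"
    and ij_commute: "x \<in> A \<Longrightarrow> i x * j x = j x * i x"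
begin

lemmas A_closed = is_subgroupD[OF A]

lemma i_one: "i 1 = 1" and j_one: "j 1 = 1"
  using i_mult[OF A_closed(1) A_closed(1)] j_mult[OF A_closed(1) A_closed(1)]
    mult_left_cancel_iff[of _ _ 1] by (metis mult_1_right)+

lemma i_inverse: "x \<in> A \<Longrightarrow> i (inverse x) = inverse (i x)"
  by (rule inverse_eqI[symmetric]) (simp add: i_one A_closed flip: i_mult)

lemma j_inverse: "x \<in> A \<Longrightarrow> j (inverse x) = inverse (j x)"
  by (rule inverse_eqI[symmetric]) (simp add: j_one A_closed flip: j_mult)

lemma i_comm: "x \<in> A \<Longrightarrow> y \<in> A \<Longrightarrow> i (comm x y) = comm (i x) (i y)"
  by (simp add: comm_def i_mult i_inverse A_closed)

lemma i_power: "x \<in> A \<Longrightarrow> i (x ^ n) = i x ^ n"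
  by (induction n) (simp_all add: i_one i_mult A_closed)

definition tns :: "'g \<Rightarrow> 'g \<Rightarrow> 'b" where
  "tns g h = comm (i g) (j h)"

text \<open>In the relation for gh, the relations for g and h allow i g and j g to be cancelled on
  the left and i h and j h on the right. This gives the claim for h^-1, hence the inner statement
  for general h.\<close>

lemma tns_eq_comm_ji:
  assumes g: "g \<in> A" and h: "h \<in> A"
  shows "tns g h = comm (j g) (i h)"
proof -
  have *: "inverse (j g) * i h * j g * inverse (i h) = inverse (i g) * j h * i g * inverse (j h)"
    if h: "h \<in> A" for h
  proof -
    have gh: "i g * i h * (j g * j h) = j g * j h * (i g * i h)"
      using ij_commute[of "g * h"] g h by (simp add: i_mult j_mult A_closed)
    have "inverse (j g) * i h * j g * inverse (i h) =
        inverse (i g * j g) * (i g * i h * (j g * j h)) * inverse (i h * j h)"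
      by (simp add: group_simps)
    also have "\<dots> = inverse (j g * i g) * (j g * j h * (i g * i h)) * inverse (j h * i h)"
      using ij_commute[OF g] ij_commute[OF h] gh by simp
    also have "\<dots> = inverse (i g) * j h * i g * inverse (j h)"
      by (simp add: group_simps)
    finally show ?thesis .
  qed
  show ?thesis
    using *[OF A_closed(3)[OF h]] h
    by (simp add: tns_def comm_def i_inverse j_inverse)
qed

lemma tns_inverse: "g \<in> A \<Longrightarrow> h \<in> A \<Longrightarrow> inverse (tns g h) = tns h g"
  by (subst tns_eq_comm_ji[of h g]) (simp_all add: tns_def inverse_comm)

lemma tns_one: "tns 1 h = 1" "tns g 1 = 1"
  by (simp_all add: tns_def i_one j_one)

text \<open>The two forms [i g, j h] and [j g, i h] give two expansions, in which k and its copy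
  play the same part.\<close>

lemma tns_mult_left:
  assumes "g \<in> A" "k \<in> A" "h \<in> A"
  shows "tns (g * k) h = inverse (i k) * tns g h * i k * tns k h"
    and "tns (g * k) h = inverse (j k) * tns g h * j k * tns k h"
  using assms tns_eq_comm_ji[of "g * k" h] tns_eq_comm_ji[of g h] tns_eq_comm_ji[of k h]
  by (simp_all add: tns_def i_mult j_mult comm_mult_left A_closed)

lemma tns_mult_right:
  assumes "g \<in> A" "k \<in> A" "h \<in> A"
  shows "tns g (h * k) = tns g k * (inverse (j k) * tns g h * j k)"
  using assms by (simp add: tns_def j_mult comm_mult_right)

section \<open>The subgroup \<open>D\<close> and conjugation on it\<close>

definition D :: "'b set" where
  "D = gspan {tns g h |g h. g \<in> A \<and> h \<in> A}"

definition B0 :: "'b set" where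
  "B0 = gspan (i ` A \<union> j ` A)"

lemma is_subgroup_D: "is_subgroup D"
  unfolding D_def by (rule is_subgroup_gspan)

lemma is_subgroup_B0: "is_subgroup B0"
  unfolding B0_def by (rule is_subgroup_gspan)

lemmas D_closed = is_subgroupD[OF is_subgroup_D]

lemma tns_in_D: "g \<in> A \<Longrightarrow> h \<in> A \<Longrightarrow> tns g h \<in> D"
  unfolding D_def by (rule gspan_base) blast

lemma i_in_B0: "g \<in> A \<Longrightarrow> i g \<in> B0" and j_in_B0: "g \<in> A \<Longrightarrow> j g \<in> B0"
  by (auto simp: B0_def intro: gspan_base)

lemma D_subset_B0: "D \<subseteq> B0"
  unfolding D_def
  by (rule gspan_minimal[OF is_subgroup_B0])
    (auto simp: tns_def intro!: is_subgroupD(4)[OF is_subgroup_B0] i_in_B0 j_in_B0)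

text \<open>For a generator, the two expansions of \<open>tns (g * k) h\<close> are compared and the
  common factor \<open>tns k h\<close> is cancelled.\<close>

lemma conj_i_eq_conj_j:
  assumes d: "d \<in> D" and k: "k \<in> A"
  shows "inverse (i k) * d * i k = inverse (j k) * d * j k"
  using d unfolding D_def
proof induction
  case (gspan_base x)
  then show ?case
    using tns_mult_left[OF _ k] by (auto dest!: mult_right_cancel_iff[THEN iffD1] simp: mult_right_cancel_iff)
next
  case (gspan_mult x y)
  have "inverse g * (x * y) * g = (inverse g * x * g) * (inverse g * y * g)" for g
    by (simp add: group_simps)
  with gspan_mult show ?case by simp
next
  case (gspan_inverse x)
  have "inverse g * inverse x * g = inverse (inverse g * x * g)" for g
    by (simp add: group_simps)
  with gspan_inverse show ?case by simp
qed simp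

lemma conj_i_in_D:
  assumes d: "d \<in> D" and k: "k \<in> A"
  shows "inverse (i k) * d * i k \<in> D"
  unfolding D_def
proof (rule gspan_conj[OF _ d[unfolded D_def]])
  fix x assume "x \<in> {tns g h |g h. g \<in> A \<and> h \<in> A}"
  then obtain g h where gh: "x = tns g h" "g \<in> A" "h \<in> A" by blast
  have "inverse (i k) * x * i k = tns (g * k) h * inverse (tns k h)"
    unfolding gh(1) using tns_mult_left(1)[OF gh(2) k gh(3)] by (simp add: mult.assoc)
  also have "\<dots> \<in> D"
    using gh k by (intro D_closed tns_in_D A_closed)
  finally show "inverse (i k) * x * i k \<in> gspan {tns g h |g h. g \<in> A \<and> h \<in> A}"
    by (simp add: D_def)
qed

lemma normalised_by_D: "normalised_by D B0"
  unfolding B0_def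
proof (rule normalised_by_gspanI2[OF is_subgroup_D])
  fix k u assume k: "k \<in> D" and "u \<in> i ` A \<union> j ` A"
  then obtain g where g: "g \<in> A" "u = i g \<or> u = j g" by blast
  then show "inverse u * k * u \<in> D"
    using conj_i_in_D[OF k g(1)] conj_i_eq_conj_j[OF k g(1)] by auto
  show "u * k * inverse u \<in> D"
    using conj_i_in_D[OF k A_closed(3)[OF g(1)]] conj_i_eq_conj_j[OF k A_closed(3)[OF g(1)]] g
    by (auto simp: i_inverse j_inverse)
qed

text \<open>Both copies of \<open>g\<close> act on \<open>D\<close> in the same way, so mentioning \<open>i g\<close> is no restriction.\<close>

definition acts :: "'b \<Rightarrow> 'g \<Rightarrow> bool" where
  "acts b g \<longleftrightarrow> (\<forall>d\<in>D. inverse b * d * b = inverse (i g) * d * i g)"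

lemma acts_i: "acts (i g) g"
  by (simp add: acts_def)

lemma acts_j: "g \<in> A \<Longrightarrow> acts (j g) g"
  by (simp add: acts_def conj_i_eq_conj_j)

lemma acts_one: "acts 1 1"
  by (simp add: acts_def i_one)

lemma acts_mult:
  assumes "acts b g" "acts b' g'" "g \<in> A" "g' \<in> A"
  shows "acts (b * b') (g * g')"
  unfolding acts_def
proof
  fix d assume d: "d \<in> D"
  have "inverse (b * b') * d * (b * b') = inverse b' * (inverse b * d * b) * b'"
    by (simp add: group_simps)
  also have "\<dots> = inverse b' * (inverse (i g) * d * i g) * b'"
    using assms(1) d by (simp add: acts_def)
  also have "\<dots> = inverse (i g') * (inverse (i g) * d * i g) * i g'"
    using assms(2) conj_i_in_D[OF d assms(3)] by (simp add: acts_def)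
  finally show "inverse (b * b') * d * (b * b') = inverse (i (g * g')) * d * i (g * g')"
    using assms by (simp add: i_mult group_simps)
qed

lemma acts_inverse:
  assumes "acts b g" "g \<in> A"
  shows "acts (inverse b) (inverse g)"
  unfolding acts_def
proof
  fix d assume "d \<in> D"
  then have "i g * d * inverse (i g) \<in> D"
    using conj_i_in_D[of d "inverse g"] assms A_closed by (simp add: i_inverse)
  then have "inverse b * (i g * d * inverse (i g)) * b = inverse (i g) * (i g * d * inverse (i g)) * i g"
    by (rule bspec[OF assms(1)[unfolded acts_def]])
  then have "inverse b * (i g * d * inverse (i g)) * b = d"
    by (simp add: mult.assoc)
  then have "b * (inverse b * (i g * d * inverse (i g)) * b) * inverse b = b * d * inverse b"
    by simp
  then show "inverse (inverse b) * d * inverse b = inverse (i (inverse g)) * d * i (inverse g)"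
    using assms by (simp add: i_inverse mult.assoc)
qed

lemma acts_comm:
  assumes "acts b g" "acts b' g'" "g \<in> A" "g' \<in> A"
  shows "acts (comm b b') (comm g g')"
  unfolding comm_def using assms by (intro acts_mult acts_inverse A_closed)

text \<open>As j h acts on \<open>D\<close> like i h, the commutator [i g, j h] acts like
  [i g, i h].\<close>

lemma acts_tns: "g \<in> A \<Longrightarrow> h \<in> A \<Longrightarrow> acts (tns g h) (comm g h)"
  unfolding tns_def by (intro acts_comm acts_i acts_j)

lemma acts_one_iff: "acts c 1 \<longleftrightarrow> (\<forall>d\<in>D. c * d = d * c)"
  unfolding acts_def i_one by (auto simp: conj_eq_self_iff)

section \<open>Weights of elements, read off from their action on \<open>D\<close>\<close>

definition Act :: "nat \<Rightarrow> 'b set" where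
  "Act n = {b. \<exists>g\<in>gam A n. acts b g}"

lemma gam_A: "g \<in> gam A n \<Longrightarrow> g \<in> A"
  using gam_subset[OF A] by blast

lemma is_subgroup_Act: "is_subgroup (Act n)"
proof -
  note sub = is_subgroupD[OF is_subgroup_gam[OF A, of n]]
  have "1 \<in> Act n"
    unfolding Act_def using sub(1) acts_one by blast
  moreover have "b * b' \<in> Act n" if "b \<in> Act n" "b' \<in> Act n" for b b'
  proof -
    obtain g g' where "g \<in> gam A n" "acts b g" "g' \<in> gam A n" "acts b' g'"
      using \<open>b \<in> Act n\<close> \<open>b' \<in> Act n\<close> unfolding Act_def by blast
    then show ?thesis
      unfolding Act_def using acts_mult[of b g b' g'] sub(2)[of g g'] gam_A by blast
  qed
  moreover have "inverse b \<in> Act n" if "b \<in> Act n" for b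
  proof -
    obtain g where "g \<in> gam A n" "acts b g"
      using \<open>b \<in> Act n\<close> unfolding Act_def by blast
    then show ?thesis
      unfolding Act_def using acts_inverse[of b g] sub(3)[of g] gam_A by blast
  qed
  ultimately show ?thesis unfolding is_subgroup_def by blast
qed

lemma Act_antimono: "m \<le> n \<Longrightarrow> Act n \<subseteq> Act m"
  unfolding Act_def using gam_antimono[OF A, of m n] by blast

lemma comm_Act: "b \<in> Act m \<Longrightarrow> b' \<in> Act n \<Longrightarrow> comm b b' \<in> Act (m + n)"
  unfolding Act_def using acts_comm gam_A comm_gam[OF A] by blast

lemma i_in_Act: "g \<in> gam A n \<Longrightarrow> i g \<in> Act n" and j_in_Act: "g \<in> gam A n \<Longrightarrow> j g \<in> Act n"
  unfolding Act_def using acts_i acts_j gam_A by blast+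

lemma tns_in_Act: "g \<in> gam A n \<Longrightarrow> h \<in> A \<Longrightarrow> tns g h \<in> Act (Suc n)"
  using comm_Act[OF i_in_Act[of g n] j_in_Act[of h 1]] by (simp add: tns_def)

lemma B0_subset_Act: "B0 \<subseteq> Act 1"
  unfolding B0_def by (rule gspan_minimal[OF is_subgroup_Act]) (auto intro: i_in_Act j_in_Act)

lemma D_subset_Act: "D \<subseteq> Act 2"
  unfolding D_def
  by (rule gspan_minimal[OF is_subgroup_Act]) (use tns_in_Act[of _ 1] in \<open>auto simp: numeral_2_eq_2\<close>)

lemma gam_subset_Act:
  assumes "K \<subseteq> Act m" "n \<ge> 1"
  shows "gam K n \<subseteq> Act (n * m)"
  using assms(2)
proof (induction n rule: dec_induct)
  case (step n)
  then have "comm_group (gam K n) K \<subseteq> Act (n * m + m)"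
    using assms(1) by (intro comm_group_minimal is_subgroup_Act comm_Act) auto
  with step show ?case by (simp add: gam_Suc add.commute)
qed (use assms in simp)

lemma acts_by_D:
  assumes "x \<in> gam A 2"
  shows "\<exists>d\<in>D. acts d x"
proof -
  have "x \<in> gspan {comm x y |x y. x \<in> A \<and> y \<in> A}"
    using assms by (simp add: numeral_2_eq_2 comm_group_def)
  then have "x \<in> A \<and> (\<exists>d\<in>D. acts d x)"
  proof induction
    case (gspan_base z)
    then show ?case using acts_tns tns_in_D A_closed(4) by blast
  next
    case gspan_one
    show ?case using acts_one D_closed(1) A_closed(1) by blast
  next
    case (gspan_mult y z)
    then obtain d d' where "d \<in> D" "acts d y" "d' \<in> D" "acts d' z" by blast
    with gspan_mult show ?case
      using acts_mult[of d y d' z] D_closed(2)[of d d'] A_closed(2)[of y z] by blast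
  next
    case (gspan_inverse y)
    then obtain d where "d \<in> D" "acts d y" by blast
    with gspan_inverse show ?case
      using acts_inverse[of d y] D_closed(3)[of d] A_closed(3)[of y] by blast
  qed
  then show ?thesis ..
qed

text \<open>On \<open>D\<close> the element i x acts like some d in \<open>D\<close>, and
  \<open>w\<close> is central in \<open>D\<close>.\<close>

lemma gam_two_centralises:
  assumes x: "x \<in> gam A 2" and w: "w \<in> D" "acts w 1"
  shows "w * i x = i x * w"
proof -
  obtain d where d: "d \<in> D" "acts d x"
    using acts_by_D[OF x] by blast
  have "inverse (i x) * w * i x = inverse d * w * d"
    using d w by (simp add: acts_def)
  also have "\<dots> = w"
    using w d by (simp add: acts_one_iff mult.assoc)
  finally have "i x * (inverse (i x) * w * i x) = i x * w" by simp
  then show ?thesis by (simp add: mult.assoc)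
qed

lemma conj_tns:
  assumes "s \<in> A" "x \<in> A" "g \<in> A" "i g * j x = j x * i g"
  shows "inverse (i g) * tns s x * i g = tns (inverse g * s * g) x"
proof -
  have "inverse (i g) * j x * i g = j x"
    using assms(4) by (simp add: conj_eq_self_iff)
  then show ?thesis
    unfolding tns_def conj_comm using assms by (simp add: i_mult i_inverse A_closed)
qed

text \<open>Conjugation by i x fixes j x and so turns {s, x} into {s[s, x], x}. In the expansion of
  the latter, i [s, x] acts on {s, x} as {s, x} itself does, that is, trivially.\<close>

lemma comm_tns_self:
  assumes "s \<in> A" "x \<in> A"
  shows "comm (tns s x) (i x) = tns (comm s x) x"
proof -
  let ?c = "comm s x"
  have c: "?c \<in> A" using assms by (simp add: A_closed)
  have "inverse (i x) * tns s x * i x = tns (inverse x * s * x) x"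
    using assms by (intro conj_tns ij_commute)
  also have "\<dots> = tns (s * ?c) x" by (simp only: conj_eq_mult_comm)
  also have "\<dots> = inverse (i ?c) * tns s x * i ?c * tns ?c x"
    by (rule tns_mult_left(1)) (use assms c in auto)
  also have "inverse (i ?c) * tns s x * i ?c = inverse (tns s x) * tns s x * tns s x"
    by (rule bspec[OF acts_tns[OF assms, unfolded acts_def] tns_in_D[OF assms], symmetric])
  finally have "inverse (i x) * tns s x * i x = tns s x * tns ?c x" by simp
  then have "tns s x * comm (tns s x) (i x) = tns s x * tns ?c x"
    by (simp only: conj_eq_mult_comm)
  then show ?thesis by (simp only: mult_left_cancel_iff)
qed

section \<open>The normal subgroups \<open>M m\<close>, and powers modulo \<open>D\<close>\<close>

definition M :: "nat \<Rightarrow> 'b set" where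
  "M m = gspan {tns x h |x h. x \<in> gam A m \<and> h \<in> A}"

lemma is_subgroup_M: "is_subgroup (M m)"
  unfolding M_def by (rule is_subgroup_gspan)

lemma M_one: "M 1 = D"
  by (simp add: M_def D_def)

lemma M_subset_D: "M m \<subseteq> D"
  unfolding M_def by (rule gspan_minimal[OF is_subgroup_D]) (auto intro: tns_in_D gam_A)

lemma M_subset_Act: "M m \<subseteq> Act m"
  unfolding M_def
  by (rule gspan_minimal[OF is_subgroup_Act])
    (use tns_in_Act[of _ m] Act_antimono[of m "Suc m"] in auto)

lemma M_trivial: "gam A m \<subseteq> {1} \<Longrightarrow> M m \<subseteq> {1}"
  unfolding M_def
  by (rule gspan_minimal) (use normalised_byD(1)[OF normalised_by_one] tns_one in auto)

lemma normalised_by_M: "normalised_by (M m) B0"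
proof -
  have j: "inverse (j k) * d * j k \<in> M m" if d: "d \<in> M m" and k: "k \<in> A" for d k
    unfolding M_def
  proof (rule gspan_conj[OF _ d[unfolded M_def]])
    fix y assume "y \<in> {tns x h |x h. x \<in> gam A m \<and> h \<in> A}"
    then obtain x h where y: "y = tns x h" "x \<in> gam A m" "h \<in> A" by blast
    have "inverse (j k) * y * j k = inverse (tns x k) * tns x (h * k)"
      unfolding y(1) using y k gam_A by (subst tns_mult_right) simp_all
    then show "inverse (j k) * y * j k \<in> gspan {tns x h |x h. x \<in> gam A m \<and> h \<in> A}"
      using y(2,3) k A_closed(2)
      by (simp only:) (intro gspan.gspan_mult gspan.gspan_inverse gspan_base; blast)
  qed
  have i: "inverse (i k) * d * i k \<in> M m" if "d \<in> M m" "k \<in> A" for d k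
    using j[OF that] that by (simp only: conj_i_eq_conj_j[OF subsetD[OF M_subset_D]])
  show ?thesis
    unfolding B0_def
  proof (rule normalised_by_gspanI2[OF is_subgroup_M])
    fix k u assume k: "k \<in> M m" and "u \<in> i ` A \<union> j ` A"
    then obtain g where g: "g \<in> A" "u = i g \<or> u = j g" by blast
    then show "inverse u * k * u \<in> M m" using i[OF k g(1)] j[OF k g(1)] by auto
    show "u * k * inverse u \<in> M m"
      using i[OF k A_closed(3)[OF g(1)]] j[OF k A_closed(3)[OF g(1)]] g
      by (auto simp: i_inverse j_inverse)
  qed
qed

text \<open>Modulo \<open>D\<close> the two copies commute, so elements are products i g * j h
  modulo \<open>D\<close> and powers are taken componentwise; \<open>P g h\<close> is the
  corresponding coset.\<close>

lemma power_in_D: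
  assumes b: "b \<in> B0" and e: "\<And>x. x \<in> A \<Longrightarrow> x ^ e = 1"
  shows "b ^ e \<in> D"
proof -
  define P where "P g h = {i g * j h * d |d. d \<in> D}" for g h
  have PI: "i g * j h * d \<in> P g h" if "d \<in> D" for g h d
    using that by (auto simp: P_def)
  have mult: "b * b' \<in> P (g * g') (h * h')"
    if b: "b \<in> P g h" "b' \<in> P g' h'" and A: "g \<in> A" "h \<in> A" "g' \<in> A" "h' \<in> A" for b b' g h g' h'
  proof -
    obtain d d' where d: "d \<in> D" "b = i g * j h * d" "d' \<in> D" "b' = i g' * j h' * d'"
      using b by (auto simp: P_def)
    let ?x = "comm (j h) (i g')"
    have "b * b' = i (g * g') * j (h * h') *
        ((inverse (j h') * ?x * j h') * (inverse (i g' * j h') * d * (i g' * j h')) * d')"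
      using A by (simp add: d i_mult j_mult comm_def group_simps)
    moreover have "?x \<in> D"
      using tns_in_D[of h g'] A by (simp add: tns_eq_comm_ji)
    moreover have "i g' * j h' \<in> B0"
      using A by (intro is_subgroupD(2)[OF is_subgroup_B0] i_in_B0 j_in_B0)
    ultimately show ?thesis
      using d A by (auto intro!: PI D_closed normalised_byD(3)[OF normalised_by_D] j_in_B0)
  qed
  have "\<exists>g\<in>A. \<exists>h\<in>A. b \<in> P g h"
    using b unfolding B0_def
  proof induction
    case (gspan_base x)
    then show ?case
      using PI[of 1 _ 1] PI[of 1 1] A_closed(1) D_closed(1) by (auto simp: i_one j_one)
  next
    case gspan_one
    then show ?case
      using PI[of 1 1 1] A_closed(1) D_closed(1) by (auto simp: i_one j_one)
  next
    case (gspan_mult x y)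
    then show ?case using mult A_closed(2) by blast
  next
    case (gspan_inverse x)
    then obtain g h d where x: "g \<in> A" "h \<in> A" "d \<in> D" "x = i g * j h * d"
      by (auto simp: P_def)
    have "inverse x = i (inverse g) * j (inverse h) *
        (comm (inverse (j h)) (inverse (i g)) *
          (i g * j h * inverse d * inverse (i g * j h)))"
      using x by (simp add: i_inverse j_inverse comm_def group_simps)
    moreover have "comm (inverse (j h)) (inverse (i g)) \<in> D"
      using tns_in_D[of "inverse h" "inverse g"] x
      by (simp add: tns_eq_comm_ji i_inverse j_inverse A_closed)
    moreover have "i g * j h * inverse d * inverse (i g * j h) \<in> D"
      using x by (intro normalised_byD(4)[OF normalised_by_D] D_closed
          is_subgroupD(2)[OF is_subgroup_B0] i_in_B0 j_in_B0)
    ultimately show ?case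
      using x by (metis PI A_closed(3) D_closed(2))
  qed
  then obtain g h where gh: "g \<in> A" "h \<in> A" "b \<in> P g h" by blast
  have "b ^ n \<in> P (g ^ n) (h ^ n)" for n
  proof (induction n)
    case 0
    then show ?case using PI[of 1 1 1] D_closed(1) by (simp add: i_one j_one)
  next
    case (Suc n)
    then show ?case using mult[OF gh(3) Suc] gh A_closed by simp
  qed
  from this[of e] show ?thesis
    using e gh by (auto simp: P_def i_one j_one)
qed

end

section \<open>The situation modulo \<open>M q\<close>\<close>

locale weak_comm_trunc = weak_comm +
  fixes q :: nat
  assumes q_tns: "n \<in> gam A q \<Longrightarrow> g \<in> A \<Longrightarrow> tns n g = 1"
begin

text \<open>Conjugation by j n fixes i g and replaces h by mh with m in \<gamma>_q, where {g, mh} =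
  {g, h}. So j n centralises \<open>D\<close>, and i n acts in the same way.\<close>

lemma acts_trivially:
  assumes n: "n \<in> gam A q"
  shows "acts (i n) 1"
proof -
  have nA: "n \<in> A" using n gam_A by blast
  have tns_right: "tns g m = 1" if "m \<in> gam A q" "g \<in> A" for g m
    using tns_inverse[of m g] q_tns[OF that] that gam_A by simp
  have "i n * d = d * i n" if "d \<in> D" for d
    using that unfolding D_def
  proof induction
    case (gspan_base d)
    then obtain g h where gh: "d = tns g h" "g \<in> A" "h \<in> A" by blast
    have "i g * j n = j n * i g"
      using tns_right[OF n gh(2)] by (simp add: tns_def comm_eq_one_iff)
    then have ig: "inverse (j n) * i g * j n = i g"
      by (simp add: mult.assoc)
    define m where "m = comm n (inverse h)"
    have m: "m \<in> gam A q"
      unfolding m_def using n gh A_closed(3) normalised_byD(5)[OF normalised_by_gam[OF A]] by blast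
    have "inverse (i n) * d * i n = inverse (j n) * d * j n"
      by (rule conj_i_eq_conj_j) (use gh nA tns_in_D in auto)
    also have "\<dots> = tns g (inverse n * h * n)"
      unfolding gh(1) tns_def conj_comm ig
      using gh nA by (simp add: j_mult j_inverse A_closed)
    also have "inverse n * h * n = m * h"
      by (simp add: m_def comm_def group_simps)
    also have "tns g (m * h) = tns g h"
      using m gh gam_A[OF m] by (simp add: tns_mult_right tns_right)
    finally show ?case by (simp add: gh(1) conj_eq_self_iff)
  next
    case (gspan_mult x y)
    then show ?case by (metis mult.assoc)
  next
    case (gspan_inverse x)
    then show ?case by (metis conj_eq_self_iff mult.assoc mult_inverse_self mult_1_right inverse_mult_cancel)
  qed simp
  then show ?thesis by (simp add: acts_one_iff)
qed

lemma acts_one_if_Act: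
  assumes "b \<in> Act n" "q \<le> n"
  shows "acts b 1"
proof -
  obtain g where g: "g \<in> gam A n" "acts b g" using assms by (auto simp: Act_def)
  then have "g \<in> gam A q" using gam_antimono[OF A assms(2)] by blast
  then have "acts (i g) 1" by (rule acts_trivially)
  with g show ?thesis by (simp add: acts_def i_one)
qed

text \<open>\<gamma>_(p-1)(K) has weight (p - 1)m \<ge> q, hence centralises \<open>D\<close> and in
  particular \<open>K\<close>.\<close>

lemma gam_trivial:
  assumes K: "K \<subseteq> D" "K \<subseteq> Act m" "q \<le> (p - 1) * m" and p: "prime p"
  shows "gam K p \<subseteq> {1}"
proof -
  have p2: "p \<ge> 2" using p by (rule prime_ge_2_nat)
  have "gam K (p - 1) \<subseteq> Act ((p - 1) * m)"
    using p2 by (intro gam_subset_Act K) simp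
  then have "comm_group (gam K (p - 1)) K \<subseteq> {1}"
    using acts_one_if_Act[OF _ K(3)] K(1)
    by (intro comm_group_minimal normalised_byD(1)[OF normalised_by_one])
      (auto simp: comm_eq_one_iff acts_one_iff)
  then show ?thesis
    using gam_Suc[of "p - 1" K] p2 by simp
qed

lemma span_exponent:
  assumes S: "S \<subseteq> D" "S \<subseteq> Act m" "q \<le> (p - 1) * m" and p: "prime p"
    and e: "\<And>y. y \<in> S \<Longrightarrow> y ^ p ^ r = 1" and x: "x \<in> gspan S"
  shows "x ^ p ^ r = 1"
  by (rule gspan_exponent[OF p gam_trivial e x])
    (use S p gspan_minimal[OF is_subgroup_D] gspan_minimal[OF is_subgroup_Act] in auto)

lemma comm_conj_eq_tns:
  assumes "x \<in> A" "h \<in> A"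
  shows "inverse (i x) * (inverse (j h) * i x * j h) = tns x h"
  by (simp add: tns_def comm_def mult.assoc)

lemma pair_subset_B0:
  assumes "x \<in> A" "h \<in> A"
  shows "gspan {i x, tns x h} \<subseteq> B0"
  using assms D_subset_B0 tns_in_D i_in_B0 by (intro gspan_minimal[OF is_subgroup_B0]) auto

lemma gam_pair_subset_D:
  assumes x: "x \<in> A" and h: "h \<in> A" and n: "n \<ge> 2"
  shows "gam (gspan {i x, tns x h}) n \<subseteq> D"
proof (rule gam_least[OF is_subgroup_gspan])
  note B0 = pair_subset_B0[OF x h]
  show "comm y z \<in> D" if "y \<in> gspan {i x, tns x h}" "z \<in> gspan {i x, tns x h}" for y z
  proof (rule comm_gspan[OF normalised_by_D _ _ _ that])
    show "{i x, tns x h} \<subseteq> B0" "{i x, tns x h} \<subseteq> B0" using B0 by (auto intro: gspan_base)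
    fix y z assume "y \<in> {i x, tns x h}" "z \<in> {i x, tns x h}"
    then show "comm y z \<in> D"
      using normalised_byD(5,6)[OF normalised_by_D] tns_in_D[OF x h] i_in_B0[OF x] D_closed(1)
      by auto
  qed
  show "comm y z \<in> D" if "y \<in> D" "z \<in> gspan {i x, tns x h}" for y z
    using that B0 by (intro normalised_byD(5)[OF normalised_by_D]) auto
qed (use n is_subgroup_D in auto)

lemma gam_pair_trivialI:
  assumes x: "x \<in> A" and h: "h \<in> A" and p: "prime p"
    and "\<And>w. w \<in> gam (gspan {i x, tns x h}) (p - 1) \<Longrightarrow> w * i x = i x * w \<and> w * tns x h = tns x h * w"
  shows "gam (gspan {i x, tns x h}) p \<subseteq> {1}"
proof -
  let ?H = "gspan {i x, tns x h}"
  have "comm_group (gam ?H (p - 1)) ?H \<subseteq> {1}"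
  proof (rule comm_group_minimal[OF normalised_byD(1)[OF normalised_by_one]])
    fix w y assume w: "w \<in> gam ?H (p - 1)" and y: "y \<in> ?H"
    show "comm w y \<in> {1}"
      by (rule comm_gspan_right[OF normalised_by_one _ _ y])
        (use assms(4)[OF w] in \<open>auto simp: comm_eq_one_iff\<close>)
  qed
  then show ?thesis
    using gam_Suc[of "p - 1" ?H] prime_ge_2_nat[OF p] by simp
qed

text \<open>{x, h} is the product of x^-1 and a conjugate of x, both of order dividing p^r, inside a
  group of class less than p.\<close>

lemma tns_power_eq_one:
  assumes x: "x \<in> A" "x ^ p ^ r = 1" and h: "h \<in> A" and p: "prime p"
    and H: "gam (gspan {i x, tns x h}) p \<subseteq> {1}"
  shows "tns x h ^ p ^ r = 1"
proof -
  let ?a = "inverse (i x)" and ?b = "inverse (j h) * i x * j h"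
  have ix: "i x ^ p ^ r = 1"
    using x i_power[of x "p ^ r"] i_one by simp
  have ab: "?a * ?b = tns x h" by (rule comm_conj_eq_tns[OF x(1) h])
  then have b: "?b = i x * tns x h" by (metis mult_inverse_cancel)
  have "gspan {?a, ?b} \<subseteq> gspan {i x, tns x h}"
    by (rule gspan_minimal[OF is_subgroup_gspan]) (auto simp: b intro: gspan.intros)
  then have "gam (gspan {?a, ?b}) p \<subseteq> {1}"
    using gam_mono H by blast
  then have "(?a * ?b) ^ p ^ r = 1"
    by (rule power_mult_eq_one[OF p]) (simp_all add: ix conj_power flip: inverse_power)
  then show ?thesis by (simp only: ab)
qed

text \<open>As p - 1 \<ge> 2, the term \<gamma>_(p-1) of the pair lies in \<open>D\<close>, and by
  weight it is central there. Since m \<ge> 2, x lies in \<gamma>_2 and so commutes with it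
  too.\<close>

lemma tns_power_eq_one_high:
  assumes m: "m \<ge> 2" "q \<le> (p - 1) * m" and p: "prime p" "odd p"
    and x: "x \<in> gam A m" "x ^ p ^ r = 1" and h: "h \<in> A"
  shows "tns x h ^ p ^ r = 1"
proof (rule tns_power_eq_one[OF gam_A[OF x(1)] x(2) h p(1) gam_pair_trivialI[OF gam_A[OF x(1)] h p(1)]])
  let ?H = "gspan {i x, tns x h}"
  note xA = gam_A[OF x(1)]
  have p3: "p - 1 \<ge> 2"
    using p prime_ge_2_nat[OF p(1)] by (cases "p = 2") auto
  have "?H \<subseteq> Act m"
    using x h tns_in_Act[of x m] Act_antimono[of m "Suc m"] i_in_Act
    by (intro gspan_minimal[OF is_subgroup_Act]) auto
  then have "gam ?H (p - 1) \<subseteq> Act ((p - 1) * m)"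
    using p3 by (intro gam_subset_Act) auto
  moreover have "gam ?H (p - 1) \<subseteq> D"
    by (rule gam_pair_subset_D[OF xA h p3])
  moreover fix w assume "w \<in> gam ?H (p - 1)"
  ultimately have w: "w \<in> D" "acts w 1"
    using acts_one_if_Act[OF _ m(2)] by auto
  moreover have "x \<in> gam A 2" using x gam_antimono[OF A m(1)] by blast
  ultimately show "w * i x = i x * w \<and> w * tns x h = tns x h * w"
    using gam_two_centralises[of x w] tns_in_D[OF xA h] by (auto simp: acts_one_iff)
qed

section \<open>Commutators of elements of \<open>D\<close>, graded by total weight; the first step
  for odd p\<close>

definition D_term :: "nat \<Rightarrow> 'b set" where
  "D_term k = D \<inter> Act k"

definition T :: "nat \<Rightarrow> 'b set" where
  "T n = gspan {comm a b |a b. \<exists>k l. a \<in> D_term k \<and> b \<in> D_term l \<and> n \<le> k + l}"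

lemma is_subgroup_T: "is_subgroup (T n)"
  unfolding T_def by (rule is_subgroup_gspan)

lemma comm_in_T: "a \<in> D_term k \<Longrightarrow> b \<in> D_term l \<Longrightarrow> n \<le> k + l \<Longrightarrow> comm a b \<in> T n"
  unfolding T_def by (rule gspan_base) blast

lemma T_antimono: "m \<le> n \<Longrightarrow> T n \<subseteq> T m"
  unfolding T_def by (rule gspan_mono) (use order_trans in blast)

lemma is_subgroup_D_term: "is_subgroup (D_term k)"
  using D_closed is_subgroupD[OF is_subgroup_Act] by (auto simp: D_term_def is_subgroup_def)

lemma comm_D_term: "a \<in> D_term k \<Longrightarrow> b \<in> B0 \<Longrightarrow> b \<in> Act l \<Longrightarrow> comm a b \<in> D_term (k + l)"
  using normalised_byD(5)[OF normalised_by_D] comm_Act by (auto simp: D_term_def)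

lemma normalised_by_D_term: "normalised_by (D_term k) B0"
  unfolding normalised_by_def
proof (intro conjI ballI)
  fix a u assume a: "a \<in> D_term k" and u: "u \<in> B0"
  have "comm a u \<in> D_term (k + 1)"
    using a u B0_subset_Act by (intro comm_D_term) auto
  then have "comm a u \<in> D_term k"
    using Act_antimono[of k "k + 1"] by (auto simp: D_term_def)
  then show "inverse u * a * u \<in> D_term k"
    using a by (simp add: conj_eq_mult_comm is_subgroupD(2)[OF is_subgroup_D_term])
qed (rule is_subgroup_D_term is_subgroup_B0)+

lemma normalised_by_T: "normalised_by (T n) B0"
  unfolding T_def
proof (rule normalised_by_gspanI[OF is_subgroup_B0])
  fix x u
  assume "x \<in> {comm a b |a b. \<exists>k l. a \<in> D_term k \<and> b \<in> D_term l \<and> n \<le> k + l}" and u: "u \<in> B0"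
  then obtain a b k l where x: "x = comm a b" "a \<in> D_term k" "b \<in> D_term l" "n \<le> k + l"
    by blast
  have "inverse u * x * u \<in> T n"
    unfolding x(1) conj_comm using x(2-) u
    by (intro comm_in_T[of _ k _ l] normalised_byD(3)[OF normalised_by_D_term])
  then show "inverse u * x * u \<in>
      gspan {comm a b |a b. \<exists>k l. a \<in> D_term k \<and> b \<in> D_term l \<and> n \<le> k + l}"
    by (simp only: T_def)
qed

lemma D_eq_D_term: "D = D_term 1"
  using D_subset_B0 B0_subset_Act by (auto simp: D_term_def)

lemma T_subset_D: "T n \<subseteq> D"
  unfolding T_def
  by (rule gspan_minimal[OF is_subgroup_D]) (auto simp: D_term_def intro: D_closed)

lemma comm_T_D:
  assumes t: "t \<in> T n" and d: "d \<in> D"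
  shows "comm t d \<in> T (Suc n)"
proof (rule comm_gspan[OF normalised_by_T _ _ _ t[unfolded T_def] gspan_base[of d "{d}"]])
  show "{comm a b |a b. \<exists>k l. a \<in> D_term k \<and> b \<in> D_term l \<and> n \<le> k + l} \<subseteq> B0"
    using D_subset_B0 D_closed by (auto simp: D_term_def)
  show "{d} \<subseteq> B0" using d D_subset_B0 by auto
  fix x y assume "x \<in> {comm a b |a b. \<exists>k l. a \<in> D_term k \<and> b \<in> D_term l \<and> n \<le> k + l}" "y \<in> {d}"
  then obtain a b k l where x: "x = comm a b" "y = d" "a \<in> D_term k" "b \<in> D_term l" "n \<le> k + l"
    by blast
  have "comm a b \<in> D_term (k + l)"
    using x D_subset_B0 by (intro comm_D_term) (auto simp: D_term_def)
  then show "comm x y \<in> T (Suc n)"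
    using x d D_eq_D_term by (auto intro: comm_in_T[of _ "k + l" _ 1])
qed simp

text \<open>With u = [a, x] and v = [b, x], conjugation by x sends z = [a, b] to [au, bv]. Both u
  and v have weight one more than a and b, so this equals z modulo \<open>T (Suc n)\<close>.\<close>

lemma comm_T_i:
  assumes t: "t \<in> T n" and x: "x \<in> A"
  shows "comm t (i x) \<in> T (Suc n)"
proof (rule comm_gspan[OF normalised_by_T _ _ _ t[unfolded T_def] gspan_base[of "i x" "{i x}"]])
  show "{comm a b |a b. \<exists>k l. a \<in> D_term k \<and> b \<in> D_term l \<and> n \<le> k + l} \<subseteq> B0"
    using D_subset_B0 D_closed by (auto simp: D_term_def)
  show "{i x} \<subseteq> B0" using x i_in_B0 by auto
  fix z y assume "z \<in> {comm a b |a b. \<exists>k l. a \<in> D_term k \<and> b \<in> D_term l \<and> n \<le> k + l}" "y \<in> {i x}"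
  then obtain a b k l where z: "z = comm a b" "y = i x" "a \<in> D_term k" "b \<in> D_term l" "n \<le> k + l"
    by blast
  define u v where "u = comm a (i x)" and "v = comm b (i x)"
  have ix: "i x \<in> B0" "i x \<in> Act 1"
    using x i_in_B0 B0_subset_Act by auto
  have uv: "u \<in> D_term (Suc k)" "v \<in> D_term (Suc l)"
    unfolding u_def v_def using comm_D_term[OF z(3) ix] comm_D_term[OF z(4) ix] by simp_all
  have bv: "b * v \<in> D_term l"
    using normalised_byD(3)[OF normalised_by_D_term z(4) ix(1)]
    by (simp add: v_def conj_eq_mult_comm)
  have vu: "v * u \<in> D"
    using uv D_closed(2) by (auto simp: D_term_def)
  have uB: "u \<in> B0" "z \<in> B0"
    using uv z D_subset_B0 D_closed by (auto simp: D_term_def)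
  have zT: "z \<in> T n"
    using z by (auto intro: comm_in_T)
  let ?K = "T (Suc n)"
  have "inverse (i x) * z * i x = comm (a * u) (b * v)"
    by (simp only: z(1) conj_comm) (simp only: conj_eq_mult_comm u_def v_def)
  \<comment> \<open>The factors are a conjugate of [a, v], a conjugate of z, and [u, bv]; only the
    middle one is nontrivial modulo \<open>?K\<close>.\<close>
  also have "\<dots> = (inverse u * comm a v * u) * (inverse (v * u) * z * (v * u)) * comm u (b * v)"
    by (simp add: z(1) comm_def group_simps)
  also have "\<dots> = (inverse u * comm a v * u) * (z * comm z (v * u)) * comm u (b * v)"
    by (simp only: conj_eq_mult_comm[of "v * u"])
  finally have "z * comm z (i x) = (inverse u * comm a v * u) * (z * comm z (v * u)) * comm u (b * v)"
    by (simp only: conj_eq_mult_comm)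
  then have "inverse z * (z * comm z (i x)) =
      (inverse z * (inverse u * comm a v * u) * z) * comm z (v * u) * comm u (b * v)"
    by (simp add: mult.assoc)
  then have "comm z (i x) =
      (inverse z * (inverse u * comm a v * u) * z) * comm z (v * u) * comm u (b * v)"
    by simp
  also have "\<dots> \<in> ?K"
  proof (rule is_subgroupD(2)[OF is_subgroup_T is_subgroupD(2)[OF is_subgroup_T]])
    have "comm a v \<in> ?K" using z uv by (auto intro: comm_in_T)
    then show "inverse z * (inverse u * comm a v * u) * z \<in> ?K"
      by (rule normalised_byD(3)[OF normalised_by_T normalised_byD(3)[OF normalised_by_T _ uB(1)] uB(2)])
    show "comm z (v * u) \<in> ?K" by (rule comm_T_D[OF zT vu])
    show "comm u (b * v) \<in> ?K" using z(5) by (auto intro: comm_in_T[OF uv(1) bv])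
  qed
  finally show "comm z y \<in> ?K" by (simp add: z(2))
qed simp

text \<open>The mixed commutators [a, \<mu>] and [\<kappa>, b] vanish, and [a, b] is fixed under
  conjugation by \<kappa> and \<mu>.\<close>

lemma comm_mult_centraliser:
  assumes "a \<in> D" "b \<in> D" "acts \<kappa> 1" "acts \<mu> 1"
  shows "comm (a * \<kappa>) (b * \<mu>) = comm a b * comm \<kappa> \<mu>"
proof -
  have c: "\<kappa> * d = d * \<kappa>" "\<mu> * d = d * \<mu>" if "d \<in> D" for d
    using assms that by (auto simp: acts_one_iff)
  have "inverse \<kappa> * comm a b * \<kappa> = comm a b" "inverse \<mu> * comm a b * \<mu> = comm a b"
    using c[OF D_closed(4)[OF assms(1,2)]] by (simp_all add: conj_eq_self_iff)
  moreover have "comm a \<mu> = 1" "comm \<kappa> b = 1"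
    using c assms by (simp_all add: comm_eq_one_iff)
  ultimately show ?thesis
    unfolding comm_mult_left unfolding comm_mult_right by simp
qed

text \<open>Writing \<open>i s = a \<kappa>\<close> and \<open>i t = b \<mu>\<close> with \<open>a, b \<in> D\<close> and \<open>\<kappa>, \<mu>\<close> centralising \<open>D\<close>,
  the commutators \<open>[a, b]\<close> and \<open>[\<kappa>, \<mu>]\<close> differ by an element of \<open>i \<gamma>\<^sub>q\<close>; the second copy of \<open>A\<close>
  moves \<open>\<kappa>\<close> and \<open>\<mu>\<close> only by elements of \<open>Z(D)\<close>, so it fixes \<open>[\<kappa>, \<mu>]\<close>.\<close>

lemma T_central:
  assumes t: "t \<in> T q" and x: "x \<in> A"
  shows "t * i x = i x * t"
proof -
  have "comm t (i x) \<in> {1}"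
  proof (rule comm_gspan[OF normalised_by_one _ _ _ t[unfolded T_def] gspan_base[of "i x" "{i x}"]])
    fix z y assume "z \<in> {comm a b |a b. \<exists>k l. a \<in> D_term k \<and> b \<in> D_term l \<and> q \<le> k + l}" "y \<in> {i x}"
    then obtain a b k l where z: "z = comm a b" "y = i x" "a \<in> D_term k" "b \<in> D_term l" "q \<le> k + l"
      by blast
    then obtain s t where st: "s \<in> gam A k" "acts a s" "t \<in> gam A l" "acts b t"
      by (auto simp: D_term_def Act_def)
    have stA: "s \<in> A" "t \<in> A" using st gam_A by auto
    have ab: "a \<in> D" "b \<in> D" using z by (auto simp: D_term_def)
    have acts: "acts (inverse d * i s) 1" if "acts d s" "s \<in> A" for d s
      using acts_mult[OF acts_inverse[OF that] acts_i A_closed(3)[OF that(2)] that(2)] by simp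
    have fixed: "\<exists>w\<in>D. acts w 1 \<and> inverse (j x) * (inverse d * i s) * j x = w * (inverse d * i s)"
      if d: "d \<in> D" "acts d s" "s \<in> A" for d s
    proof -
      let ?l = "inverse d * i s"
      let ?w = "comm ?l (j x)"
      have "?w = inverse (i s) * comm (inverse d) (j x) * i s * tns s x"
        by (simp add: comm_mult_left tns_def)
      moreover have "\<dots> \<in> D"
        using d x by (intro D_closed(2) tns_in_D normalised_byD(3)[OF normalised_by_D]
            normalised_byD(5)[OF normalised_by_D] D_closed(3) j_in_B0 i_in_B0)
      ultimately have w: "?w \<in> D" by simp
      have "acts ?w (comm 1 x)"
        using acts[OF d(2,3)] acts_j[OF x] A_closed(1) x by (rule acts_comm)
      then have "acts ?w 1" by simp
      moreover have "inverse (j x) * ?l * j x = ?w * ?l"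
        using acts[OF d(2,3)] w by (simp only: conj_eq_mult_comm acts_one_iff)
      ultimately show ?thesis using w by blast
    qed
    define \<kappa> \<mu> where "\<kappa> = inverse a * i s" and "\<mu> = inverse b * i t"
    have act: "acts \<kappa> 1" "acts \<mu> 1"
      using acts st stA by (auto simp: \<kappa>_def \<mu>_def)
    obtain w where w: "w \<in> D" "acts w 1" "inverse (j x) * \<kappa> * j x = w * \<kappa>"
      using fixed[OF ab(1) st(2) stA(1)] by (auto simp: \<kappa>_def)
    obtain w' where w': "w' \<in> D" "acts w' 1" "inverse (j x) * \<mu> * j x = w' * \<mu>"
      using fixed[OF ab(2) st(4) stA(2)] by (auto simp: \<mu>_def)
    have "i (comm s t) = comm (a * \<kappa>) (b * \<mu>)"
      using stA by (simp add: i_comm \<kappa>_def \<mu>_def)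
    also have "\<dots> = z * comm \<kappa> \<mu>"
      unfolding z(1) by (rule comm_mult_centraliser[OF ab act])
    finally have zst: "z = i (comm s t) * inverse (comm \<kappa> \<mu>)"
      by (simp add: mult.assoc)
    \<comment> \<open>The weights k and l add up to at least q, so by \<open>q_tns\<close> the
      element i [s, t] commutes with j x.\<close>
    have "comm s t \<in> gam A q"
      using comm_gam[OF A st(1,3)] gam_antimono[OF A z(5)] by blast
    then have 1: "inverse (j x) * i (comm s t) * j x = i (comm s t)"
      using q_tns[of "comm s t" x] x by (simp add: conj_eq_self_iff tns_def comm_eq_one_iff)
    have "inverse (j x) * comm \<kappa> \<mu> * j x = comm (w * \<kappa>) (w' * \<mu>)"
      by (simp only: conj_comm w(3) w'(3))
    also have "\<dots> = comm w w' * comm \<kappa> \<mu>"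
      by (rule comm_mult_centraliser[OF w(1) w'(1) act])
    also have "comm w w' = 1"
      using w(2) w'(1) unfolding comm_eq_one_iff acts_one_iff by blast
    finally have 2: "inverse (j x) * comm \<kappa> \<mu> * j x = comm \<kappa> \<mu>" by simp
    have "inverse (j x) * z * j x =
        (inverse (j x) * i (comm s t) * j x) * inverse (inverse (j x) * comm \<kappa> \<mu> * j x)"
      unfolding zst by (simp add: group_simps)
    then have "inverse (j x) * z * j x = z"
      unfolding 1 2 zst .
    \<comment> \<open>Both copies of x act alike on \<open>D\<close>, so invariance under j x passes
      to i x.\<close>
    moreover have "z \<in> D" using ab D_closed z by simp
    ultimately have "inverse (i x) * z * i x = z"
      using conj_i_eq_conj_j x by simp
    then show "comm z y \<in> {1}"
      by (simp add: conj_eq_self_iff comm_eq_one_iff z(2))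
  qed auto
  then show ?thesis by (simp add: comm_eq_one_iff)
qed

text \<open>By \<open>comm_tns_self\<close>, bracketing with x takes {s, x} to {[s, x], x}; the
  brackets of {s, x} with \<open>D\<close>, and those of \<open>T n\<close> with x or
  \<open>D\<close>, fall into \<open>T (Suc n)\<close>. Normality of the spans under x and
  \<open>D\<close> extends this from generators to all elements.\<close>

lemma gam_pair_subset:
  assumes x: "x \<in> A" and h: "h \<in> A" and n: "n \<ge> 2"
  shows "gam (gspan {i x, tns x h}) n \<subseteq> gspan ({tns s x |s. s \<in> gam A n} \<union> T n)"
proof -
  define Y where "Y n = gspan ({tns s x |s. s \<in> gam A n} \<union> T n)" for n
  let ?H = "gspan {i x, tns x h}" and ?U = "insert (i x) D"
  have H: "?H \<subseteq> gspan ?U"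
    by (rule gspan_mono) (use tns_in_D[OF x h] in auto)
  have UB: "?U \<subseteq> B0" using D_subset_B0 i_in_B0[OF x] by auto
  have sub: "is_subgroup (Y n)" for n by (simp add: Y_def is_subgroup_gspan)
  have YI: "tns s x \<in> Y n" if "s \<in> gam A n" for s n
    unfolding Y_def using that by (intro gspan_base) blast
  have TY: "t \<in> Y n" if "t \<in> T n" for t n
    unfolding Y_def using that by (intro gspan_base) blast
  have YD: "{tns s x |s. s \<in> gam A n} \<union> T n \<subseteq> D" for n
    using T_subset_D tns_in_D gam_A x by blast
  have tns_D: "comm (tns s x) d \<in> T (Suc n)" if "s \<in> gam A n" "d \<in> D" for s d n
  proof (rule comm_in_T)
    show "tns s x \<in> D_term (Suc n)"
      using that x gam_A by (auto simp: D_term_def tns_in_Act tns_in_D)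
    show "d \<in> D_term 1" using that D_eq_D_term by simp
  qed simp
  have Y_U: "normalised_by (Y n) (gspan ?U)" for n
  proof (rule normalised_by_gspanI2[OF sub])
    have D: "inverse d * k * d \<in> Y n" if k: "k \<in> Y n" and d: "d \<in> D" for k d
      unfolding Y_def
    proof (rule gspan_conj[OF _ k[unfolded Y_def]])
      fix y assume y: "y \<in> {tns s x |s. s \<in> gam A n} \<union> T n"
      have "comm y d \<in> T (Suc n)"
        using y tns_D d comm_T_D by blast
      then have "comm y d \<in> T n" using T_antimono[of n "Suc n"] by auto
      then have "y * comm y d \<in> Y n"
        using y YI TY is_subgroupD(2)[OF sub] by blast
      then show "inverse d * y * d \<in> gspan ({tns s x |s. s \<in> gam A n} \<union> T n)"
        by (simp only: conj_eq_mult_comm Y_def)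
    qed
    have I: "inverse (i g) * k * i g \<in> Y n"
      if k: "k \<in> Y n" and g: "g \<in> A" and gx: "i g * j x = j x * i g" for k g
      unfolding Y_def
    proof (rule gspan_conj[OF _ k[unfolded Y_def]])
      fix y assume "y \<in> {tns s x |s. s \<in> gam A n} \<union> T n"
      then consider s where "y = tns s x" "s \<in> gam A n" | "y \<in> T n" by blast
      then have "inverse (i g) * y * i g \<in> Y n"
      proof cases
        case 1
        have "inverse g * s * g \<in> gam A n"
          using 1 g by (intro normalised_byD(3)[OF normalised_by_gam[OF A]])
        then show ?thesis
          unfolding 1(1) conj_tns[OF gam_A[OF 1(2)] x g gx] by (rule YI)
      next
        case 2
        then show ?thesis
          by (intro TY normalised_byD(3)[OF normalised_by_T] i_in_B0 g)
      qed
      then show "inverse (i g) * y * i g \<in> gspan ({tns s x |s. s \<in> gam A n} \<union> T n)"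
        by (simp only: Y_def)
    qed
    \<comment> \<open>Prepares conjugation in the opposite direction, where \<open>conj_tns\<close>
      is used with x^-1.\<close>
    have gx: "i (inverse x) * j x = j x * i (inverse x)"
      using ij_commute[OF x] commute_inverse[of "inverse (i x)" "j x"] by (simp add: i_inverse x)
    show "inverse u * k * u \<in> Y n" if "k \<in> Y n" "u \<in> ?U" for k u
      using that D I[OF _ x ij_commute[OF x]] by blast
    show "u * k * inverse u \<in> Y n" if "k \<in> Y n" "u \<in> ?U" for k u
      using that D[of k "inverse u"] I[OF _ A_closed(3)[OF x] gx] x
      by (auto simp: i_inverse D_closed)
  qed
  have gen: "comm y z \<in> Y (Suc n)"
    if "y \<in> {tns s x |s. s \<in> gam A n} \<union> T n" "z \<in> {i x, tns x h}" "n \<ge> 1" for y z n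
  proof -
    have Y1: "comm (tns s x) (i x) \<in> Y (Suc n)" if "s \<in> gam A n" for s
      unfolding comm_tns_self[OF gam_A[OF that] x]
      using comm_gam_one[OF A that x \<open>n \<ge> 1\<close>] by (rule YI)
    have Y2: "comm (tns s x) (tns x h) \<in> Y (Suc n)" if "s \<in> gam A n" for s
      by (rule TY[OF tns_D[OF that tns_in_D[OF x h]]])
    have Y3: "comm t (i x) \<in> Y (Suc n)" "comm t (tns x h) \<in> Y (Suc n)" if "t \<in> T n" for t
      by (rule TY[OF comm_T_i[OF that x]]) (rule TY[OF comm_T_D[OF that tns_in_D[OF x h]]])
    from that(1,2) show ?thesis
      using Y1 Y2 Y3 by (elim UnE CollectE exE conjE insertE) auto
  qed
  have U: "{i x, tns x h} \<subseteq> gspan ?U" "{tns s x |s. s \<in> gam A n} \<union> T n \<subseteq> gspan ?U" for n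
    using tns_in_D[OF x h] YD[of n] by (auto intro!: gspan_base)
  show ?thesis
  proof (rule gam_least[OF is_subgroup_gspan _ _ _ n, where F = Y, unfolded Y_def])
    show "is_subgroup (gspan ({tns s x |s. s \<in> gam A n} \<union> T n))" for n
      by (rule is_subgroup_gspan)
    show "comm y z \<in> gspan ({tns s x |s. s \<in> gam A 2} \<union> T 2)" if "y \<in> ?H" "z \<in> ?H" for y z
      unfolding Y_def[symmetric]
    proof (rule comm_gspan[OF Y_U U(1) U(1) _ that])
      \<comment> \<open>\<open>comm_tns_self\<close> treats {h, x} rather than the generator {x, h}
        = {h, x}^-1. Conjugating the inverse of [{h, x}, x] converts one case into the
        other.\<close>
      have *: "comm (tns x h) (i x) \<in> Y 2"
      proof -
        have "comm (tns h x) (i x) \<in> Y 2"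
          using gen[of "tns h x" 1 "i x"] h by (auto simp: numeral_2_eq_2)
        then have "tns h x * inverse (comm (tns h x) (i x)) * inverse (tns h x) \<in> Y 2"
          using tns_in_D[OF h x]
          by (intro normalised_byD(4)[OF Y_U] is_subgroupD(3)[OF sub]) (auto intro: gspan_base)
        moreover have "tns h x * inverse (comm (tns h x) (i x)) * inverse (tns h x) = comm (tns x h) (i x)"
          unfolding tns_inverse[OF h x, symmetric] by (simp add: comm_def group_simps)
        ultimately show ?thesis by simp
      qed
      have "comm (i x) (tns x h) \<in> Y 2"
        using is_subgroupD(3)[OF sub *] by (simp add: inverse_comm)
      with * show "comm y z \<in> Y 2" if "y \<in> {i x, tns x h}" "z \<in> {i x, tns x h}" for y z
        using that is_subgroupD(1)[OF sub] by auto
    qed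
    show "comm y z \<in> gspan ({tns s x |s. s \<in> gam A (Suc n)} \<union> T (Suc n))"
      if "2 \<le> n" "y \<in> gspan ({tns s x |s. s \<in> gam A n} \<union> T n)" "z \<in> ?H" for n y z
      unfolding Y_def[symmetric]
      by (rule comm_gspan[OF Y_U U(2)[of n] U(1) _ that(2,3)]) (use gen that(1) in auto)
  qed
qed

text \<open>For s in \<gamma>_(p-1) the elements {s, x} are trivial, because \<gamma>_(p-1) lies in
  \<gamma>_q. So \<gamma>_(p-1) of the pair lies in \<open>T q\<close>, which commutes with i x by
  \<open>T_central\<close> and centralises \<open>D\<close> by weight.\<close>

lemma tns_power_eq_one_first:
  assumes q: "q \<le> p - 1" and p: "prime p" "odd p"
    and x: "x \<in> A" "x ^ p ^ r = 1" and h: "h \<in> A"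
  shows "tns x h ^ p ^ r = 1"
proof (rule tns_power_eq_one[OF x h p(1) gam_pair_trivialI[OF x(1) h p(1)]])
  let ?H = "gspan {i x, tns x h}"
  have p3: "p - 1 \<ge> 2"
    using p prime_ge_2_nat[OF p(1)] by (cases "p = 2") auto
  have "{tns s x |s. s \<in> gam A (p - 1)} \<union> T (p - 1) \<subseteq> T q"
    using q_tns x gam_antimono[OF A q] T_antimono[OF q] is_subgroupD(1)[OF is_subgroup_T] by auto
  then have "gam ?H (p - 1) \<subseteq> T q"
    using gam_pair_subset[OF x(1) h p3] gspan_minimal[OF is_subgroup_T] by blast
  moreover have "acts w 1" if "w \<in> T q" for w
  proof (rule acts_one_if_Act)
    show "w \<in> Act q"
      using that unfolding T_def
    proof induction
      case (gspan_base w)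
      then show ?case using comm_Act Act_antimono by (fastforce simp: D_term_def)
    qed (auto intro: is_subgroupD[OF is_subgroup_Act])
  qed simp
  moreover fix w assume "w \<in> gam ?H (p - 1)"
  ultimately show "w * i x = i x * w \<and> w * tns x h = tns x h * w"
    using T_central[OF _ x(1)] tns_in_D[OF x(1) h] by (auto simp: acts_one_iff)
qed

section \<open>Exponents of \<open>M m\<close> modulo \<open>M q\<close>, for odd p and for p =
  2\<close>

lemma M_exponent_odd:
  assumes m: "m \<ge> 1" "q \<le> (p - 1) * m" and p: "prime p" "odd p"
    and e: "\<And>x. x \<in> A \<Longrightarrow> x ^ p ^ r = 1" and y: "y \<in> M m"
  shows "y ^ p ^ r = 1"
proof (rule span_exponent[OF _ _ m(2) p(1) _ y[unfolded M_def]])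
  show "{tns x h |x h. x \<in> gam A m \<and> h \<in> A} \<subseteq> D"
    using tns_in_D gam_A by blast
  show "{tns x h |x h. x \<in> gam A m \<and> h \<in> A} \<subseteq> Act m"
    using tns_in_Act[of _ m] Act_antimono[of m "Suc m"] by auto
  fix z assume "z \<in> {tns x h |x h. x \<in> gam A m \<and> h \<in> A}"
  then obtain x h where z: "z = tns x h" "x \<in> gam A m" "h \<in> A" by blast
  show "z ^ p ^ r = 1"
  proof (cases "m = 1")
    case True
    then show ?thesis
      using z m p e gam_A tns_power_eq_one_first by simp
  next
    case False
    with m have "m \<ge> 2" by simp
    then show ?thesis
      unfolding z(1) using m(2) p z(2) e[OF gam_A[OF z(2)]] z(3)
      by (rule tns_power_eq_one_high)
  qed
qed

text \<open>Since {[h, x], x} = 1, the element {x, h} commutes with x, and x{x, h} is a conjugate of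
  x; so no factor 2 is lost. \<open>D\<close> is abelian because its elements have weight 2.\<close>

lemma D_exponent_two:
  assumes q: "q \<le> 2" and e: "\<And>x. x \<in> A \<Longrightarrow> x ^ 2 ^ r = 1" and y: "y \<in> D"
  shows "y ^ 2 ^ r = 1"
proof (rule span_exponent[where p = 2 and m = 2, OF _ _ _ _ _ y[unfolded D_def]])
  show "{tns g h |g h. g \<in> A \<and> h \<in> A} \<subseteq> D" using tns_in_D by blast
  then show "{tns g h |g h. g \<in> A \<and> h \<in> A} \<subseteq> Act 2" using D_subset_Act by blast
  fix z assume "z \<in> {tns g h |g h. g \<in> A \<and> h \<in> A}"
  then obtain x h where z: "z = tns h x" "x \<in> A" "h \<in> A" by blast
  have "comm h x \<in> gam A 2"
    using z comm_in_comm_group by (auto simp: numeral_2_eq_2)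
  then have "comm (tns h x) (i x) = 1"
    using q_tns[of "comm h x" x] gam_antimono[OF A q] z by (auto simp: comm_tns_self)
  then have "inverse (tns x h) * i x = i x * inverse (tns x h)"
    using z by (simp add: tns_inverse comm_eq_one_iff)
  then have "i x * tns x h = tns x h * i x"
    by (rule commute_inverse)
  then have "(i x * tns x h) ^ 2 ^ r = i x ^ 2 ^ r * tns x h ^ 2 ^ r"
    by (rule commuting_power_mult)
  moreover have "i x * tns x h = inverse (j h) * i x * j h"
    using comm_conj_eq_tns[OF z(2,3)] by (metis mult_inverse_cancel)
  moreover have "i x ^ 2 ^ r = 1"
    using i_power[OF z(2), of "2 ^ r"] e[OF z(2)] i_one by simp
  ultimately have "tns x h ^ 2 ^ r = 1" by (simp add: conj_power)
  then show "z ^ 2 ^ r = 1"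
    using z inverse_power[of "tns x h" "2 ^ r"] by (simp add: tns_inverse)
qed (use q in auto)

text \<open>A generator {x, h} is a product of x^-1 and a conjugate of x in a group of class at most
  two, which costs the factor 2. Products cost no further factor, since commutators within
  \<open>M m\<close> have order dividing \<open>e\<close>.\<close>

lemma M_exponent_two:
  assumes m: "m \<ge> 2" "q \<le> 2 * m" and e: "\<And>x. x \<in> A \<Longrightarrow> x ^ e = 1" and y: "y \<in> M m"
  shows "y ^ (2 * e) = 1"
proof -
  have central: "w * i x = i x * w" if "w \<in> D" "w \<in> Act (2 * m)" "x \<in> gam A m" for w x
    using gam_two_centralises[of x w] acts_one_if_Act[OF that(2) m(2)] that
      gam_antimono[OF A m(1)] by blast
  have ix: "i x ^ e = 1" if "x \<in> A" for x
    using i_power[OF that, of e] e[OF that] i_one by simp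
  show ?thesis
    using y unfolding M_def
  proof induction
    case (gspan_base z)
    then obtain x h where z: "z = tns x h" "x \<in> gam A m" "h \<in> A" by blast
    note xA = gam_A[OF z(2)]
    let ?a = "inverse (i x)" and ?b = "inverse (j h) * i x * j h"
    have ab: "?a * ?b = tns x h" by (rule comm_conj_eq_tns[OF xA z(3)])
    then have b: "?b = i x * tns x h" by (metis mult_inverse_cancel)
    let ?H = "gspan {i x, tns x h}"
    have in_H: "?a \<in> ?H" "?b \<in> ?H"
      by (auto simp: b intro: gspan.intros)
    have "gam ?H 2 \<subseteq> D"
      by (rule gam_pair_subset_D[OF xA z(3)]) simp
    moreover have "gam ?H 2 \<subseteq> Act (2 * m)"
      using z tns_in_Act[of x m] Act_antimono[of m "Suc m"] i_in_Act
      by (intro gam_subset_Act gspan_minimal[OF is_subgroup_Act]) auto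
    moreover have "comm ?b ?a \<in> gam ?H 2"
      using comm_in_comm_group[OF in_H(2,1)] by (simp add: numeral_2_eq_2)
    ultimately have w: "comm ?b ?a \<in> D" "comm ?b ?a \<in> Act (2 * m)" by auto
    have c1: "comm ?b ?a * i x = i x * comm ?b ?a"
      using central[OF w z(2)] .
    have c2: "comm ?b ?a * tns x h = tns x h * comm ?b ?a"
      using acts_one_if_Act[OF w(2) m(2)] tns_in_D[OF xA z(3)] by (simp add: acts_one_iff)
    have ca: "comm ?b ?a * ?a = ?a * comm ?b ?a"
      using commute_inverse[of "i x" "comm ?b ?a"] commute_inverse[of ?a "comm ?b ?a"] c1
      by (metis inverse_inverse_self)
    have cb: "comm ?b ?a * ?b = ?b * comm ?b ?a"
    proof -
      define c where "c = comm ?b ?a"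
      have "c * (i x * tns x h) = i x * tns x h * c"
        using c1 c2 unfolding c_def[symmetric] by (metis mult.assoc)
      then show ?thesis unfolding c_def[symmetric] unfolding b .
    qed
    have "comm ?b ?a ^ e = 1"
      by (rule comm_power_eq_one[OF _ ca]) (simp add: ix[OF xA] flip: inverse_power)
    then have "(?a * ?b) ^ (2 * e) = 1"
      using ix[OF xA]
      by (intro power_mult_eq_one_class_two[OF ca cb])
        (simp_all only: conj_power mult.commute[of 2 e] power_mult inverse_power[symmetric]
          power_one inverse_unit mult_1_right inverse_mult_self)
    then show ?case by (simp only: ab z(1))
  next
    case (gspan_mult y z)
    have yz: "y \<in> M m" "z \<in> M m" using gspan_mult by (simp_all add: M_def)
    then have yzD: "y \<in> D" "z \<in> D" using M_subset_D by auto
    \<comment> \<open>\<open>y\<close> is only known to have order dividing 2e, but it acts like i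
      s, whose order divides e. So [z, y] = [z, i s] has order dividing e.\<close>
    obtain s where s: "s \<in> gam A m" "acts y s"
      using yz M_subset_Act by (auto simp: Act_def)
    have w: "comm z y \<in> D" "comm z y \<in> Act (2 * m)"
      using D_closed(4)[OF yzD(2,1)] comm_Act[of z m y m] yz subsetD[OF M_subset_Act]
      by (auto simp: mult_2)
    have cD: "comm z y * d = d * comm z y" if "d \<in> D" for d
      using acts_one_if_Act[OF w(2) m(2)] that by (simp add: acts_one_iff)
    have "z * comm z y = z * comm z (i s)"
      using s(2) yzD(2) unfolding conj_eq_mult_comm[symmetric] by (simp add: acts_def)
    then have eq: "comm z y = comm z (i s)" by (simp only: mult_left_cancel_iff)
    have "comm z y ^ e = 1"
      unfolding eq
      by (rule comm_power_eq_one[OF ix[OF gam_A[OF s(1)]]])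
        (use central[OF w s(1)] in \<open>simp only: eq\<close>)
    then show ?case
      using gspan_mult by (intro power_mult_eq_one_class_two cD yzD)
  qed (simp_all flip: inverse_power)
qed

end

section \<open>Cayley representations and the weak commutativity group\<close>

typedef 'a bijection = "{f :: 'a \<Rightarrow> 'a. bij f}"
  by (rule exI[of _ id]) simp

setup_lifting type_definition_bijection

instantiation bijection :: (type) monoid_mult
begin

lift_definition one_bijection :: "'a bijection" is "id" by simp
lift_definition times_bijection :: "'a bijection \<Rightarrow> 'a bijection \<Rightarrow> 'a bijection" is "\<lambda>f g. f \<circ> g"
  by (rule bij_comp)

instance
proof
  fix a b c :: "'a bijection"
  show "a * b * c = a * (b * c)" by transfer (simp add: comp_assoc)
  show "1 * a = a" by transfer simp
  show "a * 1 = a" by transfer simp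
qed

end

instantiation bijection :: (type) inverse
begin

lift_definition inverse_bijection :: "'a bijection \<Rightarrow> 'a bijection" is "inv_into UNIV"
  by (rule bij_imp_bij_inv)

definition divide_bijection :: "'a bijection \<Rightarrow> 'a bijection \<Rightarrow> 'a bijection" where
  "divide_bijection a b = a * inverse b"

instance ..

end

instance bijection :: (type) group_mult
proof
  fix a b :: "'a bijection"
  show "inverse a * a = 1" by transfer (simp add: bij_is_inj)
  show "a / b = a * inverse b" by (rule divide_bijection_def)
qed

text \<open>Points outside the carrier are fixed, which gives a permutation of the whole type; in
  the class every value of the type is a group element.\<close>

definition cayley :: "('a, 'c) monoid_scheme \<Rightarrow> 'a \<Rightarrow> 'a bijection" where
  "cayley K x = Abs_bijection (\<lambda>y. if y \<in> carrier K then x \<otimes>\<^bsub>K\<^esub> y else y)"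

context group
begin

lemma Rep_cayley:
  assumes x: "x \<in> carrier G"
  shows "Rep_bijection (cayley G x) = (\<lambda>y. if y \<in> carrier G then x \<otimes> y else y)"
proof -
  have "bij (\<lambda>y. if y \<in> carrier G then x \<otimes> y else y)"
    by (rule o_bij[of "\<lambda>y. if y \<in> carrier G then inv x \<otimes> y else y"])
      (use x in \<open>auto simp: fun_eq_iff simp flip: m_assoc\<close>)
  then show ?thesis
    by (simp add: cayley_def Abs_bijection_inverse)
qed

lemma cayley_mult:
  assumes "x \<in> carrier G" "y \<in> carrier G"
  shows "cayley G (x \<otimes> y) = cayley G x * cayley G y"
  using assms
  by (simp add: Rep_bijection_inject[symmetric] times_bijection.rep_eq Rep_cayley fun_eq_iff m_assoc)

lemma cayley_one: "cayley G \<one> = 1"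
  using cayley_mult[of \<one> \<one>] mult_left_cancel_iff[of "cayley G \<one>" "cayley G \<one>" 1] by simp

lemma cayley_inv: "x \<in> carrier G \<Longrightarrow> cayley G (inv x) = inverse (cayley G x)"
  by (rule inverse_eqI[symmetric]) (simp add: cayley_one flip: cayley_mult)

lemma inj_on_cayley: "inj_on (cayley G) (carrier G)"
proof (rule inj_onI)
  fix x y assume xy: "x \<in> carrier G" "y \<in> carrier G" "cayley G x = cayley G y"
  then have "Rep_bijection (cayley G x) \<one> = Rep_bijection (cayley G y) \<one>" by simp
  with xy(1,2) show "x = y" by (simp add: Rep_cayley)
qed

lemma cayley_pow: "x \<in> carrier G \<Longrightarrow> cayley G (x [^] (n::nat)) = cayley G x ^ n"
  by (induction n) (simp_all add: cayley_one cayley_mult power_commutes)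

lemma pow_eq_one_iff_cayley: "x \<in> carrier G \<Longrightarrow> x [^] (n::nat) = \<one> \<longleftrightarrow> cayley G x ^ n = 1"
  using inj_onD[OF inj_on_cayley, of "x [^] n" \<one>] by (auto simp: cayley_one simp flip: cayley_pow)

lemma cayley_commutator:
  "x \<in> carrier G \<Longrightarrow> y \<in> carrier G \<Longrightarrow>
    cayley G (commutator G x y) = comm (cayley G x) (cayley G y)"
  by (simp add: commutator_def comm_def cayley_mult cayley_inv)

lemma commutator_closed: "x \<in> carrier G \<Longrightarrow> y \<in> carrier G \<Longrightarrow> commutator G x y \<in> carrier G"
  by (simp add: commutator_def)

lemma mult_commutator:
  assumes "x \<in> carrier G" "y \<in> carrier G"
  shows "y \<otimes> x \<otimes> commutator G x y = x \<otimes> y"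
proof (rule inj_onD[OF inj_on_cayley])
  show "cayley G (y \<otimes> x \<otimes> commutator G x y) = cayley G (x \<otimes> y)"
    using assms by (simp add: cayley_mult cayley_commutator commutator_closed comm_def mult.assoc)
qed (use assms commutator_closed in auto)

lemma is_subgroup_cayley_image: "subgroup H G \<Longrightarrow> is_subgroup (cayley G ` H)"
  unfolding is_subgroup_def
proof (intro conjI ballI)
  assume H: "subgroup H G"
  note sub = subgroup.one_closed[OF H] subgroup.m_closed[OF H] subgroup.m_inv_closed[OF H]
    subgroup.mem_carrier[OF H]
  show "1 \<in> cayley G ` H" using sub(1) cayley_one by force
  fix x y assume "x \<in> cayley G ` H" "y \<in> cayley G ` H"
  then show "x * y \<in> cayley G ` H" using sub cayley_mult by (auto simp flip: cayley_mult)
next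
  assume H: "subgroup H G"
  note sub = subgroup.m_inv_closed[OF H] subgroup.mem_carrier[OF H]
  fix x assume "x \<in> cayley G ` H"
  then show "inverse x \<in> cayley G ` H" using sub by (auto simp flip: cayley_inv)
qed

lemma lower_central_subgroup: "subgroup (lower_central G k) G"
proof (induction k)
  case (Suc k)
  then show ?case
    using commutator_closed subgroup.mem_carrier[OF Suc]
    by (auto simp: commutator_subgroup_def intro!: generate_is_subgroup)
qed (simp add: subgroup_self)

lemma gam_cayley_subset: "gam (cayley G ` carrier G) (Suc k) \<subseteq> cayley G ` lower_central G k"
proof (induction k)
  case (Suc k)
  show ?case
    unfolding gam.simps
  proof (rule comm_group_minimal[OF is_subgroup_cayley_image[OF lower_central_subgroup]])
    fix x y assume x: "x \<in> gam (cayley G ` carrier G) (Suc k)" and y: "y \<in> cayley G ` carrier G"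
    obtain a b where ab: "a \<in> lower_central G k" "x = cayley G a" "b \<in> carrier G" "y = cayley G b"
      using x y Suc by blast
    have "comm x y = cayley G (commutator G a b)"
      using ab subgroup.mem_carrier[OF lower_central_subgroup] by (simp add: cayley_commutator)
    moreover have "commutator G a b \<in> lower_central G (Suc k)"
      using ab by (auto simp: commutator_subgroup_def intro: generate.incl)
    ultimately show "comm x y \<in> cayley G ` lower_central G (Suc k)" by blast
  qed
qed simp

end

text \<open>Representing \<open>U / K\<close> on its cosets keeps the quotient inside the class \<open>group_mult\<close>.\<close>

lemma quotient_map:
  fixes U K :: "'b::group_mult set"
  assumes K: "normalised_by K U" and KU: "K \<subseteq> U"
  obtains \<pi> :: "'b \<Rightarrow> 'b set bijection"
  where "\<And>x y. x \<in> U \<Longrightarrow> y \<in> U \<Longrightarrow> \<pi> (x * y) = \<pi> x * \<pi> y" "\<And>x. x \<in> U \<Longrightarrow> \<pi> x = 1 \<longleftrightarrow> x \<in> K"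
proof -
  define R :: "'b monoid" where "R = \<lparr>carrier = U, monoid.mult = (*), one = 1\<rparr>"
  note U = is_subgroupD[OF normalised_byD(2)[OF K]]
  have R: "carrier R = U" "x \<otimes>\<^bsub>R\<^esub> y = x * y" "\<one>\<^bsub>R\<^esub> = 1" for x y
    by (simp_all add: R_def)
  interpret R: group R
  proof (rule groupI)
    fix x assume "x \<in> carrier R"
    then show "\<exists>y\<in>carrier R. y \<otimes>\<^bsub>R\<^esub> x = \<one>\<^bsub>R\<^esub>"
      using U(3) by (intro bexI[of _ "inverse x"]) (auto simp: R)
  qed (auto simp: R U mult.assoc)
  have inv: "inv\<^bsub>R\<^esub> x = inverse x" if "x \<in> U" for x
    using that U(3) by (intro R.inv_equality) (auto simp: R)
  have sub: "subgroup K R"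
    by (rule R.subgroupI)
      (use KU is_subgroupD[OF normalised_byD(1)[OF K]] inv in \<open>auto simp: R\<close>)
  have "K \<lhd> R"
    unfolding R.normal_inv_iff using sub normalised_byD(4)[OF K] by (simp add: R inv)
  then interpret K: normal K R .
  interpret Q: group "R Mod K" by (rule K.factorgroup_is_group)
  have Q: "K #>\<^bsub>R\<^esub> x \<in> carrier (R Mod K)" if "x \<in> U" for x
    using that by (auto simp: FactGroup_def RCOSETS_def R)
  show thesis
  proof
    fix x y assume xy: "x \<in> U" "y \<in> U"
    then have "K #>\<^bsub>R\<^esub> (x * y) = (K #>\<^bsub>R\<^esub> x) \<otimes>\<^bsub>R Mod K\<^esub> (K #>\<^bsub>R\<^esub> y)"
      using K.rcos_sum[of x y] by (simp add: R FactGroup_def)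
    then show "cayley (R Mod K) (K #>\<^bsub>R\<^esub> (x * y)) = cayley (R Mod K) (K #>\<^bsub>R\<^esub> x) * cayley (R Mod K) (K #>\<^bsub>R\<^esub> y)"
      by (simp only: Q.cayley_mult[OF Q[OF xy(1)] Q[OF xy(2)]])
  next
    fix x assume x: "x \<in> U"
    have "cayley (R Mod K) (K #>\<^bsub>R\<^esub> x) = 1 \<longleftrightarrow> K #>\<^bsub>R\<^esub> x = \<one>\<^bsub>R Mod K\<^esub>"
      using inj_on_eq_iff[OF Q.inj_on_cayley Q[OF x] Q.one_closed] unfolding Q.cayley_one .
    also have "\<dots> \<longleftrightarrow> x \<in> K"
      using R.coset_join1[OF _ _ sub, of x] R.coset_join2[OF _ sub, of x] x KU
      by (auto simp: FactGroup_def R)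
    finally show "cayley (R Mod K) (K #>\<^bsub>R\<^esub> x) = 1 \<longleftrightarrow> x \<in> K" .
  qed
qed

section \<open>Descent along the chain of the subgroups \<open>M m\<close>\<close>

context weak_comm
begin

text \<open>\<pi> is the quotient map of \<open>B0\<close> by \<open>M q\<close>, followed by a
  Cayley representation. The last clause carries power relations back: trivial in the quotient means
  lying in \<open>M q\<close>.\<close>

lemma quotient_weak_comm:
  obtains \<pi> :: "'b \<Rightarrow> 'b set bijection"
  where "weak_comm_trunc A (\<pi> \<circ> i) (\<pi> \<circ> j) q"
    and "\<And>m y. y \<in> M m \<Longrightarrow> \<pi> y \<in> weak_comm.M A (\<pi> \<circ> i) (\<pi> \<circ> j) m"
    and "\<And>y n. y \<in> D \<Longrightarrow> \<pi> y ^ n = 1 \<Longrightarrow> y ^ n \<in> M q"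
proof -
  have MB: "M m \<subseteq> B0" for m using M_subset_D D_subset_B0 by blast
  obtain \<pi> :: "'b \<Rightarrow> 'b set bijection"
    where mult: "\<And>x y. x \<in> B0 \<Longrightarrow> y \<in> B0 \<Longrightarrow> \<pi> (x * y) = \<pi> x * \<pi> y"
      and ker: "\<And>x. x \<in> B0 \<Longrightarrow> \<pi> x = 1 \<longleftrightarrow> x \<in> M q"
    using quotient_map[OF normalised_by_M[of q] MB] by blast
  note sub = is_subgroupD[OF is_subgroup_B0]
  have one: "\<pi> 1 = 1"
    using ker[OF sub(1)] is_subgroupD(1)[OF is_subgroup_M] by simp
  have inv: "\<pi> (inverse x) = inverse (\<pi> x)" if "x \<in> B0" for x
    by (rule inverse_eqI[symmetric]) (use that sub one in \<open>simp flip: mult\<close>)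
  have cm: "\<pi> (comm x y) = comm (\<pi> x) (\<pi> y)" if "x \<in> B0" "y \<in> B0" for x y
    using that by (simp add: comm_def mult inv sub)
  have pow: "\<pi> (x ^ n) = \<pi> x ^ n" if "x \<in> B0" for x n
    by (induction n) (use that in \<open>simp_all add: mult one sub\<close>)
  interpret Q: weak_comm A "\<pi> \<circ> i" "\<pi> \<circ> j"
  proof
    fix x y assume xy: "x \<in> A" "y \<in> A"
    then show "(\<pi> \<circ> i) (x * y) = (\<pi> \<circ> i) x * (\<pi> \<circ> i) y" "(\<pi> \<circ> j) (x * y) = (\<pi> \<circ> j) x * (\<pi> \<circ> j) y"
      by (simp_all add: i_mult j_mult mult i_in_B0 j_in_B0)
  next
    fix x assume "x \<in> A"
    then show "(\<pi> \<circ> i) x * (\<pi> \<circ> j) x = (\<pi> \<circ> j) x * (\<pi> \<circ> i) x"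
      by (simp add: ij_commute i_in_B0 j_in_B0 flip: mult)
  qed (rule A)
  have tns: "\<pi> (tns x h) = Q.tns x h" if "x \<in> A" "h \<in> A" for x h
    using that by (simp add: tns_def Q.tns_def cm i_in_B0 j_in_B0)
  show thesis
  proof
    show "weak_comm_trunc A (\<pi> \<circ> i) (\<pi> \<circ> j) q"
    proof
      fix n g assume n: "n \<in> gam A q" and g: "g \<in> A"
      then have "tns n g \<in> M q" unfolding M_def by (intro gspan_base) blast
      then have "\<pi> (tns n g) = 1" using ker MB by blast
      then show "Q.tns n g = 1" using tns[of n g] n g gam_A by simp
    qed
    show "\<pi> y \<in> Q.M m" if "y \<in> M m" for m y
    proof -
      have "y \<in> B0 \<and> \<pi> y \<in> Q.M m"
        using that unfolding M_def
      proof induction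
        case (gspan_base y)
        then obtain x h where y: "y = tns x h" "x \<in> gam A m" "h \<in> A" by blast
        have "Q.tns x h \<in> Q.M m"
          unfolding Q.M_def using y(2,3) by (auto intro!: gspan.gspan_base)
        moreover have "\<pi> y = Q.tns x h"
          unfolding y(1) by (rule tns[OF gam_A[OF y(2)] y(3)])
        moreover have "y \<in> B0"
          unfolding y(1) using tns_in_D[OF gam_A[OF y(2)] y(3)] D_subset_B0 by blast
        ultimately show ?case by (simp only:)
      next
        case gspan_one
        show ?case unfolding one using sub(1) is_subgroupD(1)[OF Q.is_subgroup_M] by blast
      next
        case (gspan_mult x y)
        then have xy: "x \<in> B0" "y \<in> B0" by blast+
        show ?case
          unfolding mult[OF xy]
          using gspan_mult.IH sub(2)[OF xy] is_subgroupD(2)[OF Q.is_subgroup_M] by blast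
      next
        case (gspan_inverse x)
        then have x: "x \<in> B0" by blast
        show ?case
          unfolding inv[OF x]
          using gspan_inverse.IH sub(3)[OF x] is_subgroupD(3)[OF Q.is_subgroup_M] by blast
      qed
      then show ?thesis ..
    qed
    show "y ^ n \<in> M q" if "y \<in> D" "\<pi> y ^ n = 1" for y n
      using that ker[of "y ^ n"] pow[of y n] sub(5) D_subset_B0 by auto
  qed
qed

lemma M_step_odd:
  assumes "m \<ge> 1" "prime p" "odd p" "\<And>x. x \<in> A \<Longrightarrow> x ^ p ^ r = 1" "y \<in> M m"
  shows "y ^ p ^ r \<in> M ((p - 1) * m)"
proof -
  obtain \<pi> :: "'b \<Rightarrow> 'b set bijection"
    where \<pi>: "weak_comm_trunc A (\<pi> \<circ> i) (\<pi> \<circ> j) ((p - 1) * m)"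
      "\<And>m y. y \<in> M m \<Longrightarrow> \<pi> y \<in> weak_comm.M A (\<pi> \<circ> i) (\<pi> \<circ> j) m"
      "\<And>y n. y \<in> D \<Longrightarrow> \<pi> y ^ n = 1 \<Longrightarrow> y ^ n \<in> M ((p - 1) * m)"
    by (rule quotient_weak_comm[of "(p - 1) * m"]) blast
  interpret Q: weak_comm_trunc A "\<pi> \<circ> i" "\<pi> \<circ> j" "(p - 1) * m" by (rule \<pi>(1))
  have "\<pi> y ^ p ^ r = 1"
    by (rule Q.M_exponent_odd[of m p]) (use assms \<pi>(2) in auto)
  then show ?thesis
    using \<pi>(3) assms(5) M_subset_D by blast
qed

lemma M_step_two:
  assumes "m \<ge> 2" "\<And>x. x \<in> A \<Longrightarrow> x ^ e = 1" "y \<in> M m"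
  shows "y ^ (2 * e) \<in> M (2 * m)"
proof -
  obtain \<pi> :: "'b \<Rightarrow> 'b set bijection"
    where \<pi>: "weak_comm_trunc A (\<pi> \<circ> i) (\<pi> \<circ> j) (2 * m)"
      "\<And>m y. y \<in> M m \<Longrightarrow> \<pi> y \<in> weak_comm.M A (\<pi> \<circ> i) (\<pi> \<circ> j) m"
      "\<And>y n. y \<in> D \<Longrightarrow> \<pi> y ^ n = 1 \<Longrightarrow> y ^ n \<in> M (2 * m)"
    by (rule quotient_weak_comm[of "2 * m"]) blast
  interpret Q: weak_comm_trunc A "\<pi> \<circ> i" "\<pi> \<circ> j" "2 * m" by (rule \<pi>(1))
  have "\<pi> y ^ (2 * e) = 1"
    by (rule Q.M_exponent_two[of m]) (use assms \<pi>(2) in auto)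
  then show ?thesis
    using \<pi>(3) assms(3) M_subset_D by blast
qed

lemma D_step_two:
  assumes "\<And>x. x \<in> A \<Longrightarrow> x ^ 2 ^ r = 1" "y \<in> D"
  shows "y ^ 2 ^ r \<in> M 2"
proof -
  obtain \<pi> :: "'b \<Rightarrow> 'b set bijection"
    where \<pi>: "weak_comm_trunc A (\<pi> \<circ> i) (\<pi> \<circ> j) 2"
      "\<And>m y. y \<in> M m \<Longrightarrow> \<pi> y \<in> weak_comm.M A (\<pi> \<circ> i) (\<pi> \<circ> j) m"
      "\<And>y n. y \<in> D \<Longrightarrow> \<pi> y ^ n = 1 \<Longrightarrow> y ^ n \<in> M 2"
    by (rule quotient_weak_comm[of 2]) blast
  interpret Q: weak_comm_trunc A "\<pi> \<circ> i" "\<pi> \<circ> j" 2 by (rule \<pi>(1))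
  have "\<pi> y ^ 2 ^ r = 1"
    by (rule Q.D_exponent_two) (use assms \<pi>(2)[of y 1] M_one Q.M_one in auto)
  then show ?thesis
    using \<pi>(3) assms(2) by blast
qed

text \<open>The chain starts at \<open>M 1 = D\<close>; each of the n steps multiplies the index by
  p - 1 and costs one factor p^r.\<close>

lemma D_exponent_bound_odd:
  assumes p: "prime p" "odd p" and e: "\<And>x. x \<in> A \<Longrightarrow> x ^ p ^ r = 1"
    and n: "gam A ((p - 1) ^ n) \<subseteq> {1}" and y: "y \<in> D"
  shows "y ^ (p ^ r) ^ n = 1"
proof -
  have "y ^ (p ^ r) ^ k \<in> M ((p - 1) ^ k)" for k
  proof (induction k)
    case 0
    then show ?case using y M_one by simp
  next
    case (Suc k)
    have "(p - 1) ^ k \<ge> 1" using prime_gt_1_nat[OF p(1)] by simp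
    from M_step_odd[OF this p e Suc] show ?case
      by (simp add: power_mult mult.commute[of "p ^ r"])
  qed
  then show ?thesis using M_trivial[OF n] by blast
qed

text \<open>The step from \<open>D\<close> to \<open>M 2\<close> costs only e = 2^r, each of the m
  later ones 2e; together 2^m e^(m+1).\<close>

lemma D_exponent_bound_two:
  assumes e: "\<And>x. x \<in> A \<Longrightarrow> x ^ 2 ^ r = 1"
    and m: "gam A (2 ^ (m + 1)) \<subseteq> {1}" and y: "y \<in> D"
  shows "y ^ (2 ^ m * (2 ^ r) ^ (m + 1)) = 1"
proof -
  have "y ^ (2 ^ k * (2 ^ r) ^ (k + 1)) \<in> M (2 ^ (k + 1))" for k
  proof (induction k)
    case 0
    then show ?case using D_step_two[OF e y] by simp
  next
    case (Suc k)
    have "(2::nat) ^ (k + 1) \<ge> 2" by simp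
    from M_step_two[OF this e Suc] show ?case
      by (simp add: mult.commute mult.left_commute flip: power_mult)
  qed
  then show ?thesis using M_trivial[OF m] by blast
qed

end

section \<open>Divisibility and the exponent of a group\<close>

lemma (in group) group_exponent_dvd:
  assumes n: "\<And>x. x \<in> carrier G \<Longrightarrow> x [^] (n::nat) = \<one>"
  shows "group_exponent G dvd n"
proof (cases "n = 0")
  case False
  let ?P = "\<lambda>m::nat. m > 0 \<and> (\<forall>x\<in>carrier G. x [^] m = \<one>)"
  define e where "e = (LEAST m. ?P m)"
  have Pn: "?P n" using n False by blast
  then have e: "?P e" unfolding e_def by (rule LeastI)
  have "\<exists>m>0. \<forall>x\<in>carrier G. x [^] (m::nat) = \<one>" using Pn by blast
  then have ge: "group_exponent G = e"
    unfolding group_exponent_def e_def by (rule if_P)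
  have "x [^] (n mod e) = \<one>" if x: "x \<in> carrier G" for x
  proof -
    have "\<one> = x [^] (e * (n div e) + n mod e)" using n[OF x] by simp
    also have "\<dots> = (x [^] e) [^] (n div e) \<otimes> x [^] (n mod e)"
      using x by (simp only: nat_pow_mult[symmetric] nat_pow_pow nat_pow_closed)
    also have "\<dots> = x [^] (n mod e)" using e x by simp
    finally show ?thesis by simp
  qed
  then have "\<not> n mod e > 0"
    using not_less_Least[of "n mod e" ?P] e by (auto simp: e_def[symmetric])
  then show ?thesis by (simp add: ge dvd_eq_mod_eq_0)
qed simp

lemma (in group) pow_group_exponent:
  assumes "finite (carrier G)"
  shows "group_exponent G > 0" "x \<in> carrier G \<Longrightarrow> x [^] group_exponent G = \<one>"
proof -
  let ?P = "\<lambda>m::nat. m > 0 \<and> (\<forall>x\<in>carrier G. x [^] m = \<one>)"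
  have "?P (order G)"
    using assms pow_order_eq_1 by (simp add: order_gt_0_iff_finite)
  then have "?P (LEAST m. ?P m)" "group_exponent G = (LEAST m. ?P m)"
    unfolding group_exponent_def by (rule LeastI, intro if_P) (use \<open>?P (order G)\<close> in blast)
  then show "group_exponent G > 0" "x \<in> carrier G \<Longrightarrow> x [^] group_exponent G = \<one>" by auto
qed

section \<open>Generators and relations of \<chi>(G)\<close>

context group
begin

lemma chi_hom:
  "chi_left G \<in> hom G (chi G)" "chi_right G \<in> hom G (chi G)"
proof -
  interpret N: normal "weak_comm_kernel G" "free_product G G"
    by (rule weak_comm_kernel_normal[OF is_group])
  note homs = fp_inl_hom[OF is_group is_group] fp_inr_hom[OF is_group is_group]
  show "chi_left G \<in> hom G (chi G)"
    by (rule homI)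
      (simp_all add: chi_left_def chi_def FactGroup_def N.rcos_sum hom_in_carrier[OF homs(1)]
        hom_mult[OF homs(1)] N.rcosetsI N.subset)
  show "chi_right G \<in> hom G (chi G)"
    by (rule homI)
      (simp_all add: chi_right_def chi_def FactGroup_def N.rcos_sum hom_in_carrier[OF homs(2)]
        hom_mult[OF homs(2)] N.rcosetsI N.subset)
qed

lemma chi_commute:
  assumes g: "g \<in> carrier G"
  shows "chi_left G g \<otimes>\<^bsub>chi G\<^esub> chi_right G g = chi_right G g \<otimes>\<^bsub>chi G\<^esub> chi_left G g"
proof -
  let ?F = "free_product G G" and ?N = "weak_comm_kernel G"
  let ?a = "fp_inl G G g" and ?b = "fp_inr G G g"
  interpret F: group ?F by (rule group_free_product[OF is_group is_group])
  interpret N: normal ?N ?F by (rule weak_comm_kernel_normal[OF is_group])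
  have ab: "?a \<in> carrier ?F" "?b \<in> carrier ?F"
    using hom_in_carrier[OF fp_inl_hom[OF is_group is_group] g]
      hom_in_carrier[OF fp_inr_hom[OF is_group is_group] g] by auto
  have rel: "commutator ?F ?a ?b \<in> weak_comm_relators G"
    using g by (auto simp: weak_comm_relators_def)
  \<comment> \<open>A relator belongs to the normal closure as its own conjugate by the
    unit.\<close>
  then have "\<one>\<^bsub>?F\<^esub> \<otimes>\<^bsub>?F\<^esub> commutator ?F ?a ?b \<otimes>\<^bsub>?F\<^esub> inv\<^bsub>?F\<^esub> \<one>\<^bsub>?F\<^esub> \<in> ?N"
    unfolding weak_comm_kernel_def normal_closure_def by (intro generate.incl) blast
  then have c: "commutator ?F ?a ?b \<in> ?N"
    using F.commutator_closed[OF ab] by simp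
  have eq: "?a \<otimes>\<^bsub>?F\<^esub> ?b = ?b \<otimes>\<^bsub>?F\<^esub> ?a \<otimes>\<^bsub>?F\<^esub> commutator ?F ?a ?b"
    by (rule F.mult_commutator[OF ab, symmetric])
  have "?N #>\<^bsub>?F\<^esub> (?a \<otimes>\<^bsub>?F\<^esub> ?b) = ?N #>\<^bsub>?F\<^esub> (?b \<otimes>\<^bsub>?F\<^esub> ?a)"
  proof -
    have "?N #>\<^bsub>?F\<^esub> (?a \<otimes>\<^bsub>?F\<^esub> ?b) = (?N #>\<^bsub>?F\<^esub> (?b \<otimes>\<^bsub>?F\<^esub> ?a)) <#>\<^bsub>?F\<^esub> (?N #>\<^bsub>?F\<^esub> commutator ?F ?a ?b)"
      unfolding eq using ab F.commutator_closed[OF ab] by (intro N.rcos_sum[symmetric]) auto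
    also have "?N #>\<^bsub>?F\<^esub> commutator ?F ?a ?b = ?N #>\<^bsub>?F\<^esub> \<one>\<^bsub>?F\<^esub>"
      using F.coset_join2[OF _ N.subgroup_axioms c] F.commutator_closed[OF ab]
        F.coset_join2[OF F.one_closed N.subgroup_axioms] by simp
    also have "(?N #>\<^bsub>?F\<^esub> (?b \<otimes>\<^bsub>?F\<^esub> ?a)) <#>\<^bsub>?F\<^esub> (?N #>\<^bsub>?F\<^esub> \<one>\<^bsub>?F\<^esub>) = ?N #>\<^bsub>?F\<^esub> (?b \<otimes>\<^bsub>?F\<^esub> ?a)"
      using ab by (subst N.rcos_sum) simp_all
    finally show ?thesis .
  qed
  then show ?thesis
    using ab by (simp add: chi_def chi_left_def chi_right_def FactGroup_def N.rcos_sum)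
qed

text \<open>A class of words is the product of the classes of its letters, and the coset of a letter
  lies in one of the two copies of G.\<close>

lemma chi_generated: "carrier (chi G) = generate (chi G) (chi_left G ` carrier G \<union> chi_right G ` carrier G)"
  (is "_ = generate _ ?S")
proof
  let ?F = "free_product G G" and ?N = "weak_comm_kernel G"
  interpret C: group "chi G" by (rule group_chi[OF is_group])
  interpret N: normal ?N ?F by (rule weak_comm_kernel_normal[OF is_group])
  show "generate (chi G) ?S \<subseteq> carrier (chi G)"
    using hom_in_carrier[OF chi_hom(1)] hom_in_carrier[OF chi_hom(2)]
    by (intro C.generate_incl) auto
  have word: "?N #>\<^bsub>?F\<^esub> (fp_rel G G `` {u}) \<in> generate (chi G) ?S" if "u \<in> fp_words G G" for u
    using that
  proof (induction u)
    case Nil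
    have "?N #>\<^bsub>?F\<^esub> \<one>\<^bsub>?F\<^esub> = \<one>\<^bsub>chi G\<^esub>"
      using N.coset_mult_one[OF N.subset] by (simp add: chi_def FactGroup_def)
    then show ?case by (simp add: fp_one generate.one)
  next
    case (Cons a u)
    have au: "[a] \<in> fp_words G G" "u \<in> fp_words G G"
      using Cons.prems by (cases a; simp)+
    have "?N #>\<^bsub>?F\<^esub> (fp_rel G G `` {[a]}) \<in> ?S"
      using au(1) by (cases a) (auto simp: chi_left_def chi_right_def fp_inl_def fp_inr_def)
    moreover have "?N #>\<^bsub>?F\<^esub> (fp_rel G G `` {a # u}) =
        (?N #>\<^bsub>?F\<^esub> (fp_rel G G `` {[a]})) \<otimes>\<^bsub>chi G\<^esub> (?N #>\<^bsub>?F\<^esub> (fp_rel G G `` {u}))"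
      using fp_mult_class[OF is_group is_group au] au
      by (simp add: chi_def FactGroup_def N.rcos_sum fp_class_in_carrier)
    ultimately show ?case
      using Cons.IH[OF au(2)] by (simp add: generate.incl generate.eng)
  qed
  show "carrier (chi G) \<subseteq> generate (chi G) ?S"
  proof
    fix x assume "x \<in> carrier (chi G)"
    then obtain w where w: "w \<in> carrier ?F" "x = ?N #>\<^bsub>?F\<^esub> w"
      by (auto simp: chi_def FactGroup_def RCOSETS_def)
    then show "x \<in> generate (chi G) ?S"
      using word by (auto elim: fp_carrier_cases)
  qed
qed

section \<open>\<chi>(G) as an instance of weakly commuting copies\<close>

lemma cayley_generate:
  assumes "S \<subseteq> carrier G" "x \<in> generate G S"
  shows "cayley G x \<in> gspan (cayley G ` S)"
  using assms(2)
proof induction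
  case (inv h)
  then have "cayley G (inv h) = inverse (cayley G h)"
    using assms(1) by (intro cayley_inv) auto
  then show ?case using inv by (simp add: gspan_inverse gspan_base)
next
  case (eng h1 h2)
  then show ?case
    using assms(1) generate_in_carrier by (simp add: cayley_mult gspan_mult)
qed (auto simp: cayley_one intro: gspan.intros)

text \<open>The locale wants its maps defined on elements of the class, so a permutation is first
  pulled back along the injective map \<open>cayley G\<close>.\<close>

definition chi_i :: "'a bijection \<Rightarrow> ('a + 'a) list set set bijection" where
  "chi_i a = cayley (chi G) (chi_left G (inv_into (carrier G) (cayley G) a))"

definition chi_j :: "'a bijection \<Rightarrow> ('a + 'a) list set set bijection" where
  "chi_j a = cayley (chi G) (chi_right G (inv_into (carrier G) (cayley G) a))"

lemma chi_ij_cayley: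
  assumes "x \<in> carrier G"
  shows "chi_i (cayley G x) = cayley (chi G) (chi_left G x)"
    "chi_j (cayley G x) = cayley (chi G) (chi_right G x)"
  using assms by (simp_all add: chi_i_def chi_j_def inv_into_f_f[OF inj_on_cayley])

lemma chi_weak_comm: "weak_comm (cayley G ` carrier G) chi_i chi_j"
proof
  interpret C: group "chi G" by (rule group_chi[OF is_group])
  note closed = hom_in_carrier[OF chi_hom(1)] hom_in_carrier[OF chi_hom(2)]
  show "is_subgroup (cayley G ` carrier G)"
    by (rule is_subgroup_cayley_image[OF subgroup_self])
  fix x y assume "x \<in> cayley G ` carrier G" "y \<in> cayley G ` carrier G"
  then obtain a b where ab: "x = cayley G a" "a \<in> carrier G" "y = cayley G b" "b \<in> carrier G"
    by blast
  then show "chi_i (x * y) = chi_i x * chi_i y" "chi_j (x * y) = chi_j x * chi_j y"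
    by (simp_all add: chi_ij_cayley hom_mult[OF chi_hom(1)] hom_mult[OF chi_hom(2)] C.cayley_mult closed
        flip: cayley_mult)
next
  interpret C: group "chi G" by (rule group_chi[OF is_group])
  note closed = hom_in_carrier[OF chi_hom(1)] hom_in_carrier[OF chi_hom(2)]
  fix x assume "x \<in> cayley G ` carrier G"
  then show "chi_i x * chi_j x = chi_j x * chi_i x"
    by (auto simp: chi_ij_cayley closed chi_commute simp flip: C.cayley_mult)
qed

text \<open>By \<open>power_in_D\<close>, e-th powers in \<chi>(G) lie in \<open>D\<close>; this
  gives the extra factor \<open>e\<close> in the second bound.\<close>

lemma chi_exponent_dvd:
  assumes e: "\<And>x. x \<in> carrier G \<Longrightarrow> x [^] (e::nat) = \<one>"
    and N: "\<And>y. y \<in> weak_comm.D (cayley G ` carrier G) chi_i chi_j \<Longrightarrow> y ^ N = 1"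
  shows "group_exponent ((chi G)\<lparr>carrier := D_subgroup G\<rparr>) dvd N"
    and "group_exponent (chi G) dvd N * e"
proof -
  interpret C: group "chi G" by (rule group_chi[OF is_group])
  interpret W: weak_comm "cayley G ` carrier G" chi_i chi_j by (rule chi_weak_comm)
  note closed = hom_in_carrier[OF chi_hom(1)] hom_in_carrier[OF chi_hom(2)]
  let ?S = "{commutator (chi G) x y |x y. x \<in> chi_left G ` carrier G \<and> y \<in> chi_right G ` carrier G}"
  have S: "?S \<subseteq> carrier (chi G)"
    using closed C.commutator_closed by blast
  have D: "subgroup (D_subgroup G) (chi G)"
    unfolding D_subgroup_def commutator_subgroup_def by (rule C.generate_is_subgroup[OF S])
  have "cayley (chi G) y \<in> W.D" if "y \<in> D_subgroup G" for y
  proof -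
    have "cayley (chi G) ` ?S \<subseteq> W.D"
      using closed W.tns_in_D
      by (fastforce simp: C.cayley_commutator W.tns_def simp flip: chi_ij_cayley)
    then have "gspan (cayley (chi G) ` ?S) \<subseteq> W.D"
      by (rule gspan_minimal[OF W.is_subgroup_D])
    then show ?thesis
      using C.cayley_generate[OF S] that
      unfolding D_subgroup_def commutator_subgroup_def by blast
  qed
  then have DN: "y [^]\<^bsub>chi G\<^esub> N = \<one>\<^bsub>chi G\<^esub>" if "y \<in> D_subgroup G" for y
    using that N subgroup.mem_carrier[OF D] by (simp add: C.pow_eq_one_iff_cayley)
  interpret DG: group "(chi G)\<lparr>carrier := D_subgroup G\<rparr>"
    by (rule subgroup.subgroup_is_group[OF D C.is_group])
  show "group_exponent ((chi G)\<lparr>carrier := D_subgroup G\<rparr>) dvd N"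
    by (rule DG.group_exponent_dvd) (use DN in \<open>simp flip: C.nat_pow_consistent\<close>)
  show "group_exponent (chi G) dvd N * e"
  proof (rule C.group_exponent_dvd)
    fix x assume x: "x \<in> carrier (chi G)"
    have "cayley (chi G) ` (chi_left G ` carrier G \<union> chi_right G ` carrier G) \<subseteq> W.B0"
      using W.i_in_B0 W.j_in_B0 by (auto simp flip: chi_ij_cayley)
    then have "gspan (cayley (chi G) ` (chi_left G ` carrier G \<union> chi_right G ` carrier G)) \<subseteq> W.B0"
      by (rule gspan_minimal[OF W.is_subgroup_B0])
    moreover have "x \<in> generate (chi G) (chi_left G ` carrier G \<union> chi_right G ` carrier G)"
      using x chi_generated by simp
    ultimately have "cayley (chi G) x \<in> W.B0"
      using C.cayley_generate[of "chi_left G ` carrier G \<union> chi_right G ` carrier G" x] closed by blast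
    then have "cayley (chi G) x ^ e \<in> W.D"
      by (rule W.power_in_D) (use e in \<open>auto simp flip: pow_eq_one_iff_cayley\<close>)
    then have "(cayley (chi G) x ^ e) ^ N = 1" by (rule N)
    then show "x [^]\<^bsub>chi G\<^esub> (N * e) = \<one>\<^bsub>chi G\<^esub>"
      using x by (simp add: C.pow_eq_one_iff_cayley mult.commute[of N] power_mult)
  qed
qed

text \<open>\<open>gam\<close> counts from 1 and \<open>lower_central\<close> from 0, so class c
  kills the terms of index greater than c.\<close>

lemma gam_cayley_trivial:
  assumes "has_nilpotency_class G c" "c < n"
  shows "gam (cayley G ` carrier G) n \<subseteq> {1}"
proof -
  have "gam (cayley G ` carrier G) n \<subseteq> gam (cayley G ` carrier G) (Suc c)"
    using assms(2) by (intro gam_antimono is_subgroup_cayley_image subgroup_self) simp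
  also have "\<dots> \<subseteq> cayley G ` {\<one>}"
    using gam_cayley_subset[of c] assms(1) by (simp add: has_nilpotency_class_def)
  finally show ?thesis by (simp add: cayley_one)
qed

end

section \<open>The bounds in terms of logarithms of the class\<close>

theorem theorem1p3:
  fixes G (structure) and p c :: nat
  assumes "group G"
    and "prime p"
    and "finite (carrier G)"
    and "\<exists>k. order G = p ^ k"
    and "has_nilpotency_class G c"
    and "c \<ge> 1"
  shows
    "(odd p \<longrightarrow>
       (let n = nat \<lceil>log (real p - 1) (real c + 1)\<rceil> in
          group_exponent ((chi G)\<lparr>carrier := D_subgroup G\<rparr>) dvd group_exponent G ^ n \<and>
          group_exponent (chi G) dvd group_exponent G ^ (n + 1))) \<and>
     (p = 2 \<longrightarrow>
       (let m = nat \<lfloor>log 2 (real c)\<rfloor> in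
          group_exponent ((chi G)\<lparr>carrier := D_subgroup G\<rparr>) dvd 2 ^ m * group_exponent G ^ (m + 1) \<and>
          group_exponent (chi G) dvd 2 ^ m * group_exponent G ^ (m + 2)))"
proof -
  interpret group G by fact
  let ?e = "group_exponent G" and ?A = "cayley G ` carrier G"
  interpret W: weak_comm ?A chi_i chi_j by (rule chi_weak_comm)
  have e: "x [^] ?e = \<one>" if "x \<in> carrier G" for x
    using pow_group_exponent(2)[OF assms(3) that] .
  \<comment> \<open>The exponent divides the order of G and so is a power of p, as the regularity
    results require.\<close>
  obtain k where "order G = p ^ k" using assms(4) by blast
  then have "?e dvd p ^ k"
    using pow_order_eq_1 by (intro group_exponent_dvd) auto
  then obtain r where r: "?e = p ^ r"
    using divides_primepow_nat[OF assms(2)] by blast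
  have eA: "x ^ p ^ r = 1" if "x \<in> ?A" for x
    using that e by (auto simp: r simp flip: pow_eq_one_iff_cayley)
  show ?thesis
  proof (intro conjI impI; unfold Let_def)
    assume p: "odd p"
    define n where "n = nat \<lceil>log (real p - 1) (real c + 1)\<rceil>"
    \<comment> \<open>For odd p the base p - 1 exceeds 1, and the ceiling gives c + 1 \<le> (p -
      1)^n; this kills \<gamma> at index (p - 1)^n.\<close>
    have p3: "p \<ge> 3"
      using p prime_ge_2_nat[OF assms(2)] by (cases "p = 2") auto
    then have b: "real p - 1 > 1" by simp
    have "log (real p - 1) (real c + 1) \<le> real n"
      unfolding n_def by linarith
    then have "real c + 1 \<le> (real p - 1) powr real n"
      using b by (simp add: log_le_iff)
    also have "\<dots> = real ((p - 1) ^ n)"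
      using b p3 by (simp add: powr_realpow of_nat_diff)
    finally have "c < (p - 1) ^ n" by linarith
    then have D: "y ^ ?e ^ n = 1" if "y \<in> W.D" for y
      unfolding r
      using W.D_exponent_bound_odd[OF assms(2) p eA gam_cayley_trivial[OF assms(5)] that] by blast
    show "group_exponent ((chi G)\<lparr>carrier := D_subgroup G\<rparr>) dvd ?e ^ nat \<lceil>log (real p - 1) (real c + 1)\<rceil> \<and>
        group_exponent (chi G) dvd ?e ^ (nat \<lceil>log (real p - 1) (real c + 1)\<rceil> + 1)"
      using chi_exponent_dvd[OF e D] by (simp add: n_def mult.commute)
  next
    assume p: "p = 2"
    define m where "m = nat \<lfloor>log 2 (real c)\<rfloor>"
    \<comment> \<open>The floor gives c < 2^(m+1); the passage from logarithms to powers uses c >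
      0.\<close>
    have "log 2 (real c) < real (m + 1)"
      unfolding m_def by linarith
    then have "real c < 2 powr real (m + 1)"
      using assms(6) by (simp add: log_less_iff)
    also have "\<dots> = real (2 ^ (m + 1))"
      by (subst powr_realpow) simp_all
    finally have "c < 2 ^ (m + 1)" by linarith
    then have D: "y ^ (2 ^ m * ?e ^ (m + 1)) = 1" if "y \<in> W.D" for y
      unfolding r p
      using W.D_exponent_bound_two[OF eA[unfolded p] gam_cayley_trivial[OF assms(5)] that] by blast
    show "group_exponent ((chi G)\<lparr>carrier := D_subgroup G\<rparr>) dvd 2 ^ nat \<lfloor>log 2 (real c)\<rfloor> * ?e ^ (nat \<lfloor>log 2 (real c)\<rfloor> + 1) \<and>
        group_exponent (chi G) dvd 2 ^ nat \<lfloor>log 2 (real c)\<rfloor> * ?e ^ (nat \<lfloor>log 2 (real c)\<rfloor> + 2)"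
      using chi_exponent_dvd[OF e D] by (simp add: m_def mult_ac)
  qed
qed

end
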